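(* Let $(\alpha,\beta,\gamma),(\overline{\alpha},\overline{\beta},\overline{\gamma})\in\mathbb{R}^3$ with $\beta,\overline{\beta}\notin\{0,3\}$, and suppose that the cubic parabolas $c_{\alpha,\beta,\gamma}$ and $c_{\overline{\alpha},\overline{\beta},\overline{\gamma}}$ on Cayley's ruled surface $F$ are distinct. Then $c_{\alpha,\beta,\gamma}$ and $c_{\overline{\alpha},\overline{\beta},\overline{\gamma}}$ have (a) second order dual contact at $\omega$ if, and only if, $\beta=\overline{\beta}$; (b) third order dual contact at $\omega$ if, and only if, ($\beta=\overline{\beta}$ and $\gamma=\overline{\gamma}$) or $\beta=\overline{\beta}=\frac52$; (c) fourth order dual contact at $\omega$ if, and only if, $\beta=\overline{\beta}=\frac73$ and $\gamma=\overline{\gamma}$.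
   Context: We work in the real projective space $\mathbb{P}_3(\mathbb{R})$; its points are $\mathbb{R}\mathbf{x}$ with $\mathbf{x}=(x_0,x_1,x_2,x_3)^{\mathrm T}\in\mathbb{R}^{4\times 1}$ non-zero. Planes (points of the dual projective space) are given by $\mathbb{R}(y_0,y_1,y_2,y_3)$ with a non-zero row vector in $\mathbb{R}^{1\times 4}$; the plane is $\{\mathbb{R}\mathbf{x} : \sum_i y_ix_i=0\}$. Cayley's (ruled cubic) surface is the surface $F$ with equation $3x_0x_1x_2-x_1^3-3x_3x_0^2=0$. Let $\omega$ be the plane $x_0=0$ and $U=\mathbb{R}(0,0,0,1)^{\mathrm T}$. For $(\alpha,\beta,\gamma)\in\mathbb{R}^3$ with $\beta\neq 0$ define $\Phi_{\alpha,\beta,\gamma}:\mathbb{R}^{2\times 1}\to\mathbb{R}^{4\times 1}$ by $$\Phi_{\alpha,\beta,\gamma}\big((u_0,u_1)^{\mathrm T}\big)=\Big(u_0^3,\ u_0^2(u_1-\gamma u_0),\ \frac{u_0(u_1^2+\alpha u_0^2)}{\beta},\ \frac{u_1-\gamma u_0}{3\beta}\big(3(u_1^2+\alpha u_0^2)-\beta(u_1-\gamma u_0)^2\big)\Big)^{\mathrm T}.$$ If moreover $\beta\neq 3$, the map $\mathbb{P}_1(\mathbb{R})\to\mathbb{P}_3(\mathbb{R})$, $\mathbb{R}\mathbf{u}\mapsto\mathbb{R}\,\Phi_{\alpha,\beta,\gamma}(\mathbf{u})$ is well defined, and its image is denoted by $c_{\alpha,\beta,\gamma}$; it is a twisted cubic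 (cubic parabola) contained in $F$. All these curves pass through $U$ (the image of $\mathbb{R}(0,1)^{\mathrm T}$) and have $\omega$ as their osculating plane at $U$. Contact of order $k$ of two curves at a common point means contact of order at least $k$: in an affine chart around the point, the two curves admit regular local parametrizations whose Taylor expansions at the point agree up to and including terms of degree $k$. The dual curve of a twisted cubic is the curve in the dual projective space formed by its osculating planes. Two twisted cubics have dual contact of order $k$ at a common osculating plane $\sigma$ if their dual curves have contact of order $k$ at the point $\sigma$ of the dual projective space. *)

theory Defs
  imports "HOL-Analysis.Analysis"
begin

text \<open>
  Points of the real projective space are the one-dimensional subspaces \<open>span {x}\<close>, \<open>x \<noteq> 0\<close>.
  Row vectors are also represented in \<open>real ^ 4\<close>, so that \<open>span {y}\<close>, read as a point of the dual
  projective space, is the plane \<open>{span {x} | x. x \<noteq> 0 \<and> y \<bullet> x = 0}\<close>. The homogeneous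
  coordinate with index \<open>i \<in> {0, 1, 2, 3}\<close> is the component \<open>$ (i + 1)\<close>.
\<close>

definition cayley_surface :: "(real ^ 4) set set" where
  "cayley_surface = {span {x} | x. x \<noteq> 0 \<and>
     3 * x $ 1 * x $ 2 * x $ 3 - (x $ 2) ^ 3 - 3 * x $ 4 * (x $ 1)\<^sup>2 = 0}"

definition omega :: "(real ^ 4) set" where
  "omega = span {vector [1, 0, 0, 0]}"

definition Phi :: "real \<Rightarrow> real \<Rightarrow> real \<Rightarrow> real ^ 2 \<Rightarrow> real ^ 4" where
  "Phi \<alpha> \<beta> \<gamma> u = (let u0 = u $ 1; u1 = u $ 2 in vector
     [u0 ^ 3,
      u0\<^sup>2 * (u1 - \<gamma> * u0),
      u0 * (u1\<^sup>2 + \<alpha> * u0\<^sup>2) / \<beta>,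
      (u1 - \<gamma> * u0) / (3 * \<beta>) * (3 * (u1\<^sup>2 + \<alpha> * u0\<^sup>2) - \<beta> * (u1 - \<gamma> * u0)\<^sup>2)])"

definition cubic_parabola :: "real \<Rightarrow> real \<Rightarrow> real \<Rightarrow> (real ^ 4) set set" where
  "cubic_parabola \<alpha> \<beta> \<gamma> = {span {Phi \<alpha> \<beta> \<gamma> u} | u. u \<noteq> 0}"

definition nth_deriv :: "nat \<Rightarrow> (real \<Rightarrow> 'a::real_normed_vector) \<Rightarrow> real \<Rightarrow> 'a" where
  "nth_deriv n g = ((\<lambda>f t. vector_derivative f (at t)) ^^ n) g"

text \<open>
  The affine chart on the points off the hyperplane \<open>l \<bullet> x = 0\<close> sends a point to its
  unique representative in the affine 3-space \<open>{x. l \<bullet> x = 1}\<close>.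
\<close>

definition affine_part :: "real ^ 4 \<Rightarrow> (real ^ 4) set set \<Rightarrow> (real ^ 4) set" where
  "affine_part l C = {x. l \<bullet> x = 1 \<and> span {x} \<in> C}"

text \<open>
  A regular local parametrization of \<open>C\<close> at the point \<open>P\<close>: a smooth immersion of an open interval
  around 0 that is a homeomorphism onto a relatively open part of \<open>C\<close> and maps 0 to \<open>P\<close>.
\<close>

definition local_param ::
  "(real ^ 4) set set \<Rightarrow> (real ^ 4) set \<Rightarrow> real ^ 4 \<Rightarrow> real \<Rightarrow> (real \<Rightarrow> real ^ 4) \<Rightarrow> bool" where
  "local_param C P l e g \<longleftrightarrow>
     0 < e \<and>
     (\<forall>n. \<forall>t\<in>{-e<..<e}. nth_deriv n g differentiable (at t)) \<and>
     (\<forall>t\<in>{-e<..<e}. nth_deriv 1 g t \<noteq> 0) \<and>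
     openin (top_of_set (affine_part l C)) (g ` {-e<..<e}) \<and>
     (\<exists>h. homeomorphism {-e<..<e} (g ` {-e<..<e}) g h) \<and>
     span {g 0} = P"

text \<open>Contact of order at least \<open>k\<close>.\<close>

definition contact ::
  "nat \<Rightarrow> (real ^ 4) set set \<Rightarrow> (real ^ 4) set set \<Rightarrow> (real ^ 4) set \<Rightarrow> bool" where
  "contact k C D P \<longleftrightarrow>
     (\<exists>l e g e' h. local_param C P l e g \<and> local_param D P l e' h \<and>
        (\<forall>j\<le>k. nth_deriv j g 0 = nth_deriv j h 0))"

text \<open>
  The osculating plane at \<open>P\<close> is spanned by \<open>P\<close> and the first two derivative vectors; the condition
  on the dimension makes it unique.
\<close>

definition osculating_plane ::
  "(real ^ 4) set set \<Rightarrow> (real ^ 4) set \<Rightarrow> (real ^ 4) set \<Rightarrow> bool" where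
  "osculating_plane C P \<sigma> \<longleftrightarrow>
     (\<exists>l e g y. local_param C P l e g \<and>
        dim {g 0, nth_deriv 1 g 0, nth_deriv 2 g 0} = 3 \<and>
        \<sigma> = span {y} \<and> y \<noteq> 0 \<and>
        y \<bullet> g 0 = 0 \<and> y \<bullet> nth_deriv 1 g 0 = 0 \<and> y \<bullet> nth_deriv 2 g 0 = 0)"

definition dual_curve :: "(real ^ 4) set set \<Rightarrow> (real ^ 4) set set" where
  "dual_curve C = {\<sigma>. \<exists>P\<in>C. osculating_plane C P \<sigma>}"

definition dual_contact ::
  "nat \<Rightarrow> (real ^ 4) set set \<Rightarrow> (real ^ 4) set set \<Rightarrow> (real ^ 4) set \<Rightarrow> bool" where
  "dual_contact k C D \<sigma> \<longleftrightarrow> contact k (dual_curve C) (dual_curve D) \<sigma>"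

lemma vector_4_nth:
  "(vector [a, b, c, d] :: ('a::zero) ^ 4) $ 1 = a"
  "(vector [a, b, c, d] :: ('a::zero) ^ 4) $ 2 = b"
  "(vector [a, b, c, d] :: ('a::zero) ^ 4) $ 3 = c"
  "(vector [a, b, c, d] :: ('a::zero) ^ 4) $ 4 = d"
  by (simp_all add: vector_def)

lemma Phi_nth:
  "Phi \<alpha> \<beta> \<gamma> u $ 1 = (u $ 1) ^ 3"
  "Phi \<alpha> \<beta> \<gamma> u $ 2 = (u $ 1)\<^sup>2 * (u $ 2 - \<gamma> * u $ 1)"
  "Phi \<alpha> \<beta> \<gamma> u $ 3 = u $ 1 * ((u $ 2)\<^sup>2 + \<alpha> * (u $ 1)\<^sup>2) / \<beta>"
  "Phi \<alpha> \<beta> \<gamma> u $ 4 = (u $ 2 - \<gamma> * u $ 1) / (3 * \<beta>) *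
     (3 * ((u $ 2)\<^sup>2 + \<alpha> * (u $ 1)\<^sup>2) - \<beta> * (u $ 2 - \<gamma> * u $ 1)\<^sup>2)"
  by (simp_all add: Phi_def Let_def vector_4_nth)

lemma Phi_nonzero:
  assumes "\<beta> \<notin> {0, 3}" "u \<noteq> 0"
  shows "Phi \<alpha> \<beta> \<gamma> u \<noteq> 0"
proof
  assume *: "Phi \<alpha> \<beta> \<gamma> u = 0"
  then have u1: "u $ 1 = 0"
    using Phi_nth(1)[of \<alpha> \<beta> \<gamma> u] by simp
  then have "u $ 2 \<noteq> 0"
    using assms(2) by (auto simp: vec_eq_iff forall_2)
  moreover have "u $ 2 / (3 * \<beta>) * (3 * (u $ 2)\<^sup>2 - \<beta> * (u $ 2)\<^sup>2) = 0"
    using Phi_nth(4)[of \<alpha> \<beta> \<gamma> u] u1 * by simp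
  ultimately show False
    using assms(1) by auto
qed

lemma cubic_parabola_subset_cayley_surface:
  assumes "\<beta> \<notin> {0, 3}"
  shows "cubic_parabola \<alpha> \<beta> \<gamma> \<subseteq> cayley_surface"
proof
  fix P
  assume "P \<in> cubic_parabola \<alpha> \<beta> \<gamma>"
  then obtain u where u: "u \<noteq> 0" "P = span {Phi \<alpha> \<beta> \<gamma> u}"
    by (auto simp: cubic_parabola_def)
  let ?x = "Phi \<alpha> \<beta> \<gamma> u"
  have "3 * ?x $ 1 * ?x $ 2 * ?x $ 3 - (?x $ 2) ^ 3 - 3 * ?x $ 4 * (?x $ 1)\<^sup>2 = 0"
    using assms by (simp add: Phi_nth field_simps power2_eq_square power3_eq_cube)
  then show "P \<in> cayley_surface"
    unfolding cayley_surface_def using Phi_nonzero[OF assms u(1)] u(2) by blast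
qed

end

theory Submission
  imports Defs "HOL-Computational_Algebra.Polynomial"
begin

text \<open>
  Each cubic parabola is \<open>veronese w p q = q\<^sup>3 w 0 + p q\<^sup>2 w 1 + p\<^sup>2 q w 2 + p\<^sup>3 w 3\<close> for a suitable basis
  \<open>w\<close> of the four-dimensional space. If \<open>m\<close> is the dual basis, then some
  combination of the forms \<open>m 0\<close>, \<open>m 1\<close>, \<open>m 2\<close>, \<open>m 3\<close> takes the value \<open>(p s - q r)\<^sup>3\<close> at the point with
  parameter \<open>(r, s)\<close>, and the plane where it vanishes meets the curve with multiplicity three at
  the parameter \<open>(p, q)\<close>. So the osculating planes form again a
  twisted cubic, with the frame \<open>polar_frame m\<close>, and \<open>omega\<close> is its point at the parameter \<open>(0, 1)\<close>.

  Contact forces equalities. In the dual frame \<open>n\<close> of the dual curve, the points \<open>y\<close> of the curve satisfy the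
  quadrics \<open>(n 1 \<bullet> y)\<^sup>2 = (n 0 \<bullet> y) (n 2 \<bullet> y)\<close> and \<open>(n 1 \<bullet> y) (n 2 \<bullet> y) = (n 0 \<bullet> y) (n 3 \<bullet> y)\<close>.
  Differentiating them along an arbitrary regular parametrization, up to order four, yields
  polynomial relations between the derivatives at \<open>omega\<close> and the parameters of the cubic
  (\<open>jet_at_omega\<close>). If two curves have contact of order \<open>k\<close>, the same derivatives satisfy the
  relations of both, and subtracting these relations compares the parameters: order two yields
  \<open>\<beta> = \<beta>'\<close>; order three yields \<open>(\<gamma> - \<gamma>') (4 \<beta> - 10) = 0\<close>; order four yields
  \<open>(\<gamma> - \<gamma>') (\<beta> - 4) = 0\<close>, hence \<open>\<gamma> = \<gamma>'\<close> together with order three, and then \<open>(\<alpha> - \<alpha>') (3 \<beta> - 7) = 0\<close>, where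
  \<open>\<alpha> \<noteq> \<alpha>'\<close> if the curves are distinct. No choice of chart or
  parametrization enters.

  Conversely, the homogeneous form of the dual curve lets one look for polynomials \<open>U\<close>, \<open>V\<close> such
  that the second dual curve at \<open>(U t, V t)\<close> and the first one at \<open>(t, 1)\<close> have
  coordinate vectors that agree up to degree \<open>k\<close> in \<open>t\<close>. In the chart in which
  the first parametrization is already normalized, dividing the second one by its
  denominator, which is \<open>1\<close> up to the same degree, gives two parametrizations with equal derivatives
  (\<open>contact_twisted_cubics\<close>). Comparing coefficients determines \<open>U\<close> and \<open>V\<close> degree by degree, and
  the conditions on the parameters solve the equations that remain
  (\<open>dual_contact_via_reparametrization\<close>).
\<close>

section \<open>Derivatives of scalar products and rational curves\<close>

lemma nth_deriv_simps [simp]: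
  "nth_deriv 0 g = g"
  "nth_deriv (Suc n) g = (\<lambda>t. vector_derivative (nth_deriv n g) (at t))"
  by (simp_all add: nth_deriv_def fun_eq_iff)

definition smooth_on :: "real set \<Rightarrow> (real \<Rightarrow> 'a::real_normed_vector) \<Rightarrow> bool" where
  "smooth_on I g \<longleftrightarrow> (\<forall>n. \<forall>t\<in>I. nth_deriv n g differentiable (at t))"

lemma smooth_onD:
  assumes "smooth_on I g" "t \<in> I"
  shows "(nth_deriv n g has_vector_derivative nth_deriv (Suc n) g t) (at t)"
  using assms unfolding smooth_on_def by (simp flip: vector_derivative_works)

text \<open>
  The \<open>n\<close>-th derivative of \<open>(a \<bullet> g t) * (b \<bullet> g t)\<close>, in the form given by the Leibniz rule.
\<close>

definition leibniz_sum :: "'a::real_inner \<Rightarrow> 'a \<Rightarrow> (real \<Rightarrow> 'a) \<Rightarrow> nat \<Rightarrow> real \<Rightarrow> real" where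
  "leibniz_sum a b g n t =
     (\<Sum>k\<le>n. of_nat (n choose k) * ((a \<bullet> nth_deriv k g t) * (b \<bullet> nth_deriv (n - k) g t)))"

lemma pascal_sum:
  fixes F :: "nat \<Rightarrow> nat \<Rightarrow> real"
  shows "(\<Sum>k\<le>n. of_nat (n choose k) * (F (Suc k) (n - k) + F k (Suc (n - k)))) =
         (\<Sum>k\<le>Suc n. of_nat (Suc n choose k) * F k (Suc n - k))"
proof -
  have "(\<Sum>k\<le>Suc n. of_nat (Suc n choose k) * F k (Suc n - k)) =
        F 0 (Suc n) + (\<Sum>k\<le>n. of_nat (Suc n choose Suc k) * F (Suc k) (n - k))"
    by (subst sum.atMost_Suc_shift) simp
  also have "\<dots> = (F 0 (Suc n) + (\<Sum>k\<le>n. of_nat (n choose Suc k) * F (Suc k) (n - k)))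
       + (\<Sum>k\<le>n. of_nat (n choose k) * F (Suc k) (n - k))"
    by (simp add: algebra_simps sum.distrib)
  also have "F 0 (Suc n) + (\<Sum>k\<le>n. of_nat (n choose Suc k) * F (Suc k) (n - k)) =
     (\<Sum>k\<le>Suc n. of_nat (n choose k) * F k (Suc n - k))"
    by (simp only: sum.atMost_Suc_shift) simp
  also have "\<dots> = (\<Sum>k\<le>n. of_nat (n choose k) * F k (Suc (n - k)))"
    by (auto simp: Suc_diff_le intro!: sum.cong)
  finally show ?thesis by (simp add: algebra_simps sum.distrib)
qed

lemma leibniz_sum_derivative:
  assumes "smooth_on I g" "t \<in> I"
  shows "(leibniz_sum a b g n has_real_derivative leibniz_sum a b g (Suc n) t) (at t)"
proof -
  have 1: "((\<lambda>t. c \<bullet> nth_deriv k g t) has_real_derivative c \<bullet> nth_deriv (Suc k) g t) (at t)" for c k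
    using bounded_linear.has_vector_derivative[OF bounded_linear_inner_right smooth_onD[OF assms]]
    by (simp add: has_real_derivative_iff_has_vector_derivative)
  have 2: "((\<lambda>t. of_nat (n choose k) * ((a \<bullet> nth_deriv k g t) * (b \<bullet> nth_deriv (n - k) g t)))
      has_real_derivative of_nat (n choose k) *
        ((a \<bullet> nth_deriv (Suc k) g t) * (b \<bullet> nth_deriv (n - k) g t)
          + (a \<bullet> nth_deriv k g t) * (b \<bullet> nth_deriv (Suc (n - k)) g t))) (at t)" for k
    using DERIV_cmult[OF DERIV_mult[OF 1[of a k] 1[of b "n - k"]], of "of_nat (n choose k)"]
    by (simp add: algebra_simps)
  have "((\<lambda>t. \<Sum>k\<le>n. of_nat (n choose k) * ((a \<bullet> nth_deriv k g t) * (b \<bullet> nth_deriv (n - k) g t)))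
     has_real_derivative (\<Sum>k\<le>n. of_nat (n choose k) *
        ((a \<bullet> nth_deriv (Suc k) g t) * (b \<bullet> nth_deriv (n - k) g t)
          + (a \<bullet> nth_deriv k g t) * (b \<bullet> nth_deriv (Suc (n - k)) g t)))) (at t)"
    by (rule DERIV_sum) (rule 2)
  also have "(\<Sum>k\<le>n. of_nat (n choose k) *
        ((a \<bullet> nth_deriv (Suc k) g t) * (b \<bullet> nth_deriv (n - k) g t)
          + (a \<bullet> nth_deriv k g t) * (b \<bullet> nth_deriv (Suc (n - k)) g t))) = leibniz_sum a b g (Suc n) t"
    unfolding leibniz_sum_def
    by (rule pascal_sum[of n "\<lambda>i j. (a \<bullet> nth_deriv i g t) * (b \<bullet> nth_deriv j g t)"])
  finally show ?thesis by (simp add: leibniz_sum_def[abs_def])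
qed

text \<open>
  A quadratic relation between linear forms that holds along a curve may be differentiated any number
  of times. This is how equations of a twisted cubic become conditions on the jets of all its
  parametrizations.
\<close>

lemma leibniz_sum_eq:
  assumes "open I" "smooth_on I g"
    and "\<And>t. t \<in> I \<Longrightarrow> (a \<bullet> g t) * (b \<bullet> g t) = (c \<bullet> g t) * (d \<bullet> g t)"
    and "t \<in> I"
  shows "leibniz_sum a b g n t = leibniz_sum c d g n t"
  using \<open>t \<in> I\<close>
proof (induction n arbitrary: t)
  case 0
  then show ?case using assms(3) by (simp add: leibniz_sum_def)
next
  case (Suc n)
  have "(leibniz_sum c d g n has_real_derivative leibniz_sum a b g (Suc n) t) (at t)"
    using leibniz_sum_derivative[OF assms(2) Suc.prems] assms(1) Suc.prems Suc.IH
    by (rule has_field_derivative_transform_within_open)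
  then show ?case
    using leibniz_sum_derivative[OF assms(2) Suc.prems] DERIV_unique by blast
qed

lemma leibniz_sum_numeral:
  "leibniz_sum a b g 1 t = (a \<bullet> nth_deriv 1 g t) * (b \<bullet> g t) + (a \<bullet> g t) * (b \<bullet> nth_deriv 1 g t)"
  "leibniz_sum a b g 2 t = (a \<bullet> nth_deriv 2 g t) * (b \<bullet> g t)
     + 2 * (a \<bullet> nth_deriv 1 g t) * (b \<bullet> nth_deriv 1 g t) + (a \<bullet> g t) * (b \<bullet> nth_deriv 2 g t)"
  "leibniz_sum a b g 3 t = (a \<bullet> nth_deriv 3 g t) * (b \<bullet> g t)
     + 3 * (a \<bullet> nth_deriv 2 g t) * (b \<bullet> nth_deriv 1 g t)
     + 3 * (a \<bullet> nth_deriv 1 g t) * (b \<bullet> nth_deriv 2 g t) + (a \<bullet> g t) * (b \<bullet> nth_deriv 3 g t)"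
  "leibniz_sum a b g 4 t = (a \<bullet> nth_deriv 4 g t) * (b \<bullet> g t)
     + 4 * (a \<bullet> nth_deriv 3 g t) * (b \<bullet> nth_deriv 1 g t)
     + 6 * (a \<bullet> nth_deriv 2 g t) * (b \<bullet> nth_deriv 2 g t)
     + 4 * (a \<bullet> nth_deriv 1 g t) * (b \<bullet> nth_deriv 3 g t) + (a \<bullet> g t) * (b \<bullet> nth_deriv 4 g t)"
  unfolding leibniz_sum_def
  by (simp_all add: numeral_eq_Suc)

text \<open>
  Coordinates with a common denominator \<open>q\<^sup>n\<close> and numerators that vanish at \<open>0\<close> to order \<open>m\<close>. The
  exponent \<open>n\<close> is left open because it grows under differentiation, while \<open>q\<close> stays the same; this
  makes the class closed under derivatives.
\<close>

definition rational_curve :: "real set \<Rightarrow> real poly \<Rightarrow> nat \<Rightarrow> (real \<Rightarrow> 'a::euclidean_space) \<Rightarrow> bool" where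
  "rational_curve I q m f \<longleftrightarrow> (\<exists>n P. \<forall>b\<in>Basis. monom 1 m dvd P b \<and>
      (\<forall>t\<in>I. f t \<bullet> b = poly (P b) t / poly q t ^ n))"

lemma monom_dvd_pderiv:
  assumes "monom (1::real) m dvd p"
  shows "monom 1 (m - 1) dvd pderiv p"
  using assms by (auto simp: monom_1_dvd_iff' coeff_pderiv)

text \<open>
  By the quotient rule the numerator \<open>P\<close> over \<open>q\<^sup>n\<close> becomes \<open>P' q - n P q'\<close> over \<open>q\<^bsup>n + 1\<^esup>\<close>, and the order of
  vanishing at \<open>0\<close> drops by at most one.
\<close>

lemma rational_curve_derivative:
  fixes f :: "real \<Rightarrow> 'a::euclidean_space"
  assumes "open I" and q: "\<And>t. t \<in> I \<Longrightarrow> poly q t \<noteq> 0" and "rational_curve I q m f"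
  shows "rational_curve I q (m - 1) (\<lambda>t. vector_derivative f (at t))"
    and "t \<in> I \<Longrightarrow> f differentiable (at t)"
proof -
  obtain n P where P: "\<And>b. b \<in> Basis \<Longrightarrow> monom 1 m dvd P b"
      "\<And>b t. b \<in> Basis \<Longrightarrow> t \<in> I \<Longrightarrow> f t \<bullet> b = poly (P b) t / poly q t ^ n"
    using assms(3) unfolding rational_curve_def by blast
  define R where "R b = pderiv (P b) * q - smult (of_nat n) (P b * pderiv q)" for b
  define f' :: "real \<Rightarrow> 'a" where "f' t = (\<Sum>b\<in>Basis. (poly (R b) t / poly q t ^ Suc n) *\<^sub>R b)" for t
  have f'b: "f' t \<bullet> b = poly (R b) t / poly q t ^ Suc n" if "b \<in> Basis" for t b
    using that by (simp add: f'_def)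
  have der: "(f has_vector_derivative f' t) (at t)" if t: "t \<in> I" for t
  proof -
    have "((\<lambda>t. f t \<bullet> b) has_real_derivative f' t \<bullet> b) (at t)" if b: "b \<in> Basis" for b
    proof -
      have "((\<lambda>t. poly (P b) t / poly q t ^ n) has_real_derivative f' t \<bullet> b) (at t)"
        unfolding f'b[OF b] using q[OF t]
        by (cases n) (auto intro!: derivative_eq_intros simp: R_def field_simps gr0_conv_Suc)
      then show ?thesis
        by (rule has_field_derivative_transform_within_open[OF _ assms(1) t]) (simp add: P(2) b)
    qed
    then show ?thesis
      unfolding has_vector_derivative_def
      by (subst has_derivative_componentwise_within)
        (simp add: has_real_derivative_iff_has_vector_derivative has_vector_derivative_def)
  qed
  have "monom 1 (m - 1) dvd P b" if "b \<in> Basis" for b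
    using P(1)[OF that] by (auto simp: monom_1_dvd_iff')
  then have "monom 1 (m - 1) dvd R b" if "b \<in> Basis" for b
    unfolding R_def using that monom_dvd_pderiv[OF P(1)[OF that]]
    by (intro dvd_diff dvd_mult2 dvd_smult) auto
  then show "rational_curve I q (m - 1) (\<lambda>t. vector_derivative f (at t))"
    unfolding rational_curve_def using vector_derivative_at[OF der] f'b
    by (intro exI[of _ "Suc n"] exI[of _ R]) auto
  show "f differentiable (at t)" if "t \<in> I"
    using der[OF that] by (rule differentiableI_vector)
qed

lemma rational_curve_nth_deriv:
  assumes "open I" "\<And>t. t \<in> I \<Longrightarrow> poly q t \<noteq> 0" "rational_curve I q m f"
  shows "rational_curve I q (m - n) (nth_deriv n f)"
proof (induction n)
  case (Suc n)
  then show ?case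
    using rational_curve_derivative(1)[OF assms(1,2) Suc.IH] by simp
qed (simp add: assms)

lemma rational_curve_smooth:
  assumes "open I" "\<And>t. t \<in> I \<Longrightarrow> poly q t \<noteq> 0" "rational_curve I q m f"
  shows "smooth_on I f"
  unfolding smooth_on_def using rational_curve_derivative(2)[OF assms(1,2) rational_curve_nth_deriv[OF assms]]
  by blast

lemma rational_curve_nth_deriv_0:
  assumes "open I" "\<And>t. t \<in> I \<Longrightarrow> poly q t \<noteq> 0" "rational_curve I q m f" "0 \<in> I" "n < m"
  shows "nth_deriv n f 0 = 0"
proof -
  obtain k P where P: "\<And>b. b \<in> Basis \<Longrightarrow> monom 1 (m - n) dvd P b"
      "\<And>b t. b \<in> Basis \<Longrightarrow> t \<in> I \<Longrightarrow> nth_deriv n f t \<bullet> b = poly (P b) t / poly q t ^ k"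
    using rational_curve_nth_deriv[OF assms(1-3)] unfolding rational_curve_def by blast
  have "poly (P b) 0 = 0" if "b \<in> Basis" for b
    using P(1)[OF that] assms(5) by (auto elim!: dvdE simp: poly_monom)
  then show ?thesis
    using P(2) assms(4) by (subst euclidean_eq_iff) simp
qed

lemma nth_deriv_diff:
  assumes "open I" "smooth_on I f" "smooth_on I g" "t \<in> I"
  shows "nth_deriv n (\<lambda>t. f t - g t) t = nth_deriv n f t - nth_deriv n g t"
  using assms(4)
proof (induction n arbitrary: t)
  case (Suc n)
  have "((\<lambda>t. nth_deriv n f t - nth_deriv n g t) has_vector_derivative
     nth_deriv (Suc n) f t - nth_deriv (Suc n) g t) (at t)"
    by (intro has_vector_derivative_diff smooth_onD[OF assms(2) Suc.prems] smooth_onD[OF assms(3) Suc.prems])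
  then have "(nth_deriv n (\<lambda>t. f t - g t) has_vector_derivative
     nth_deriv (Suc n) f t - nth_deriv (Suc n) g t) (at t)"
    by (rule has_vector_derivative_transform_within_open[OF _ assms(1) Suc.prems]) (simp add: Suc.IH)
  then show ?case by (simp add: vector_derivative_at)
qed simp

section \<open>Twisted cubics in dual frames\<close>

definition dual_frames :: "(nat \<Rightarrow> real ^ 4) \<Rightarrow> (nat \<Rightarrow> real ^ 4) \<Rightarrow> bool" where
  "dual_frames w m \<longleftrightarrow> (\<forall>i<4. \<forall>j<4. m i \<bullet> w j = of_bool (i = j))"

definition veronese :: "(nat \<Rightarrow> real ^ 4) \<Rightarrow> real \<Rightarrow> real \<Rightarrow> real ^ 4" where
  "veronese w p q = q ^ 3 *\<^sub>R w 0 + (p * q\<^sup>2) *\<^sub>R w 1 + (p\<^sup>2 * q) *\<^sub>R w 2 + p ^ 3 *\<^sub>R w 3"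

definition twisted_cubic :: "(nat \<Rightarrow> real ^ 4) \<Rightarrow> (real ^ 4) set set" where
  "twisted_cubic w = {span {veronese w p q} | p q. p \<noteq> 0 \<or> q \<noteq> 0}"

text \<open>
  The frame in which the osculating planes of a twisted cubic with dual frame \<open>m\<close> are parametrized: its
  entries are the coefficients of
  \<open>(p s - q r)\<^sup>3 = - q\<^sup>3 r\<^sup>3 + 3 p q\<^sup>2 r\<^sup>2 s - 3 p\<^sup>2 q r s\<^sup>2 + p\<^sup>3 s\<^sup>3\<close>, where the monomials in \<open>r\<close>, \<open>s\<close> are
  the values of \<open>m 3\<close>, \<open>m 2\<close>, \<open>m 1\<close>, \<open>m 0\<close> at the point with parameter \<open>(r, s)\<close>.
\<close>

definition polar_frame :: "(nat \<Rightarrow> real ^ 4) \<Rightarrow> nat \<Rightarrow> real ^ 4" where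
  "polar_frame m = (!) [- m 3, 3 *\<^sub>R m 2, - 3 *\<^sub>R m 1, m 0]"

definition polar_coframe :: "(nat \<Rightarrow> real ^ 4) \<Rightarrow> nat \<Rightarrow> real ^ 4" where
  "polar_coframe w = (!) [- w 3, (1 / 3) *\<^sub>R w 2, - (1 / 3) *\<^sub>R w 1, w 0]"

lemma less_4_cases: "(\<forall>i<4. P i) \<longleftrightarrow> P 0 \<and> P 1 \<and> P 2 \<and> P (3::nat)"
  by (auto simp: numeral_eq_Suc less_Suc_eq)

lemma polar_frame_nth:
  "polar_frame m 0 = - m 3" "polar_frame m 1 = 3 *\<^sub>R m 2"
  "polar_frame m 2 = - 3 *\<^sub>R m 1" "polar_frame m 3 = m 0"
  by (simp_all add: polar_frame_def)

lemma polar_frames: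
  assumes "dual_frames w m"
  shows "dual_frames (polar_frame m) (polar_coframe w)"
  using assms unfolding dual_frames_def less_4_cases polar_frame_def polar_coframe_def
  by (simp add: inner_commute)

lemma coframe_veronese:
  assumes "dual_frames w m"
  shows "m 0 \<bullet> veronese w p q = q ^ 3" "m (Suc 0) \<bullet> veronese w p q = p * q\<^sup>2"
    "m 2 \<bullet> veronese w p q = p\<^sup>2 * q" "m 3 \<bullet> veronese w p q = p ^ 3"
  using assms unfolding dual_frames_def less_4_cases veronese_def by (simp_all add: inner_add_right)

lemma veronese_scale: "veronese w (c * p) (c * q) = c ^ 3 *\<^sub>R veronese w p q"
  by (simp add: veronese_def scaleR_add_right power_mult_distrib algebra_simps power2_eq_square power3_eq_cube)

lemma veronese_affine: "q \<noteq> 0 \<Longrightarrow> veronese w p q = q ^ 3 *\<^sub>R veronese w (p / q) 1"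
  using veronese_scale[of w q "p / q" 1] by simp

lemma veronese_nonzero:
  assumes "dual_frames w m" "p \<noteq> 0 \<or> q \<noteq> 0"
  shows "veronese w p q \<noteq> 0"
  using coframe_veronese(1,4)[OF assms(1), of p q] assms(2) by auto

lemma twisted_cubic_point:
  assumes "span {x} \<in> twisted_cubic w"
  obtains c p q where "x = c *\<^sub>R veronese w p q"
proof -
  obtain p q where "span {x} = span {veronese w p q}"
    using assms by (auto simp: twisted_cubic_def)
  then have "x \<in> span {veronese w p q}"
    using span_base[of x "{x}"] by simp
  then show thesis using that by (auto simp: span_singleton)
qed

text \<open>
  Two of the quadrics through a twisted cubic. Away from the osculating plane \<open>m 0\<close> they
  already determine the curve.
\<close>

lemma twisted_cubic_quadrics:
  assumes "dual_frames w m" "span {x} \<in> twisted_cubic w"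
  shows "(m 1 \<bullet> x) * (m 1 \<bullet> x) = (m 0 \<bullet> x) * (m 2 \<bullet> x)"
    "(m 1 \<bullet> x) * (m 2 \<bullet> x) = (m 0 \<bullet> x) * (m 3 \<bullet> x)"
  using assms(2)
  by (auto elim!: twisted_cubic_point simp: coframe_veronese[OF assms(1)] power2_eq_square power3_eq_cube)

lemma span_scaleR: "c \<noteq> 0 \<Longrightarrow> span {c *\<^sub>R x} = span {x :: 'a::real_vector}"
  using span_image_scale[of "{x}" "\<lambda>_. c"] by simp

lemma veronese_1_in_twisted_cubic: "span {veronese w s 1} \<in> twisted_cubic w"
  unfolding twisted_cubic_def by force

lemma local_param_smooth: "local_param C P l e g \<Longrightarrow> smooth_on {-e<..<e} g"
  by (auto simp: local_param_def smooth_on_def)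

lemma local_param_point:
  assumes "local_param C P l e g" "t \<in> {-e<..<e}"
  shows "l \<bullet> g t = 1" "span {g t} \<in> C"
  using assms openin_imp_subset unfolding local_param_def affine_part_def by blast+

lemma local_param_0: "local_param C P l e g \<Longrightarrow> 0 \<in> {-e<..<e}"
  by (auto simp: local_param_def)

lemma inj_on_nonzero_derivative:
  assumes "\<And>t. t \<in> {a<..<b} \<Longrightarrow> (\<psi> has_real_derivative \<psi>' t) (at t)"
    and "\<And>t. t \<in> {a<..<b} \<Longrightarrow> \<psi>' t \<noteq> 0"
  shows "inj_on \<psi> {a<..<b}"
proof (rule linorder_inj_onI)
  fix x y assume xy: "x < y" "x \<in> {a<..<b}" "y \<in> {a<..<b}"
  obtain z where "z > x" "z < y" "\<psi> y - \<psi> x = (y - x) * \<psi>' z"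
    using MVT2[OF xy(1), of \<psi> \<psi>'] assms(1) xy by fastforce
  then show "\<psi> x \<noteq> \<psi> y" using assms(2)[of z] xy by auto
qed auto

lemma open_image_nonzero_derivative:
  assumes "open I" "\<And>t. t \<in> I \<Longrightarrow> (\<psi> has_real_derivative \<psi>' t) (at t)" "\<And>t. t \<in> I \<Longrightarrow> \<psi>' t \<noteq> 0"
  shows "open (\<psi> ` I)"
proof -
  have "continuous_on I \<psi>"
    using assms(2) by (meson DERIV_atLeastAtMost_imp_continuous_on DERIV_isCont continuous_at_imp_continuous_on)
  then have "\<psi> t \<in> interior (\<psi> ` I)" if "t \<in> I" for t
    using assms(2)[OF that] assms(3)[OF that] that assms(1)
    by (intro sussmann_open_mapping[of I \<psi> t "\<lambda>x. x * \<psi>' t" "\<lambda>x. x / \<psi>' t"])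
      (auto simp: has_field_derivative_def mult_commute_abs bounded_linear_divide interior_open fun_eq_iff)
  then show ?thesis by (metis image_subsetI interior_subset interior_open subset_antisym open_interior)
qed

text \<open>
  Reading off the affine parameter as the quotient \<open>r\<close> of two linear forms gives a continuous function on an
  open set which recovers \<open>\<psi> t\<close> from \<open>h t\<close>. It therefore transfers injectivity,
  openness of the image, continuity of the inverse and regularity from the real function \<open>\<psi>\<close> to the
  curve \<open>h\<close>. The set \<open>S\<close> may omit the point with parameter \<open>(1, 0)\<close>, so that the lemma applies to a
  dual curve for which only the points with finite parameter have been found.
\<close>

lemma local_param_twisted_cubic:
  assumes w: "dual_frames w m" and S: "S \<subseteq> twisted_cubic w" "\<And>s. span {veronese w s 1} \<in> S"
    and e: "0 < e" and smooth: "smooth_on {-e<..<e} h"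
    and \<psi>: "\<And>t. t \<in> {-e<..<e} \<Longrightarrow> (\<psi> has_real_derivative \<psi>' t) (at t)"
      "\<And>t. t \<in> {-e<..<e} \<Longrightarrow> \<psi>' t \<noteq> 0"
    and h: "\<And>t. t \<in> {-e<..<e} \<Longrightarrow> h t = c t *\<^sub>R veronese w (\<psi> t) 1"
      "\<And>t. t \<in> {-e<..<e} \<Longrightarrow> l \<bullet> h t = 1"
  shows "local_param S (span {veronese w (\<psi> 0) 1}) l e h"
proof -
  let ?I = "{-e<..<e}"
  define r where "r x = (m 1 \<bullet> x) / (m 0 \<bullet> x)" for x
  have c: "c t \<noteq> 0" if "t \<in> ?I" for t
    using h[OF that] by auto
  have m: "m 0 \<bullet> h t = c t" "m 1 \<bullet> h t = c t * \<psi> t" if "t \<in> ?I" for t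
    using h(1)[OF that] by (simp_all add: coframe_veronese[OF w])
  have r: "r (h t) = \<psi> t" if "t \<in> ?I" for t
    using m[OF that] c[OF that] by (simp add: r_def)
  have span_h: "span {h t} = span {veronese w (\<psi> t) 1}" if "t \<in> ?I" for t
    using h(1)[OF that] c[OF that] by (simp add: span_scaleR)
  have cont_\<psi>: "continuous_on ?I \<psi>"
    using \<psi>(1) by (meson DERIV_isCont continuous_at_imp_continuous_on)
  have inj: "inj_on \<psi> ?I"
    using \<psi> by (rule inj_on_nonzero_derivative)
  obtain \<phi> where \<phi>: "homeomorphism ?I (\<psi> ` ?I) \<psi> \<phi>"
    using inj injective_into_1d_eq_homeomorphism[OF cont_\<psi>] by (auto simp: convex_imp_path_connected)
  have "h differentiable (at t)" if "t \<in> ?I" for t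
    using smooth that unfolding smooth_on_def by (metis nth_deriv_simps(1))
  then have cont_h: "continuous_on ?I h"
    by (meson continuous_at_imp_continuous_on differentiable_imp_continuous_within)
  have cont_r: "continuous_on {x. m 0 \<bullet> x \<noteq> 0} r"
    unfolding r_def by (intro continuous_intros) auto
  have inv: "\<phi> (r (h t)) = t" if "t \<in> ?I" for t
    using \<phi> r[OF that] that by (simp add: homeomorphism_def)
  have homeo: "homeomorphism ?I (h ` ?I) h (\<phi> \<circ> r)"
    unfolding homeomorphism_def
  proof (intro conjI ballI)
    show "continuous_on (h ` ?I) (\<phi> \<circ> r)"
    proof (rule continuous_on_compose)
      show "continuous_on (h ` ?I) r"
        using cont_r by (rule continuous_on_subset) (auto simp: m c)
      have "r ` h ` ?I = \<psi> ` ?I"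
        using r by (auto simp: image_image)
      then show "continuous_on (r ` h ` ?I) \<phi>"
        using \<phi> by (simp add: homeomorphism_def)
    qed
    show "(\<phi> \<circ> r) ` h ` ?I = ?I"
      using inv by (simp add: image_image)
  qed (use cont_h inv in auto)
  have immersion: "nth_deriv 1 h t \<noteq> 0" if t: "t \<in> ?I" for t
  proof
    assume "nth_deriv 1 h t = 0"
    then have "(h has_vector_derivative 0) (at t)"
      using smooth_onD[OF smooth t, of 0] by simp
    from bounded_linear.has_vector_derivative[OF bounded_linear_inner_right this]
    have 0: "((\<lambda>t. a \<bullet> h t) has_real_derivative 0) (at t)" for a
      by (simp add: has_real_derivative_iff_has_vector_derivative)
    have "((\<lambda>t. r (h t)) has_real_derivative 0) (at t)"
      unfolding r_def using DERIV_divide[OF 0[of "m 1"] 0[of "m 0"]] m[OF t] c[OF t] by simp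
    then have "(\<psi> has_real_derivative 0) (at t)"
      by (rule has_field_derivative_transform_within_open[of _ _ _ ?I]) (use t r in auto)
    then show False
      using \<psi>[OF t] DERIV_unique by blast
  qed
  \<comment> \<open>The image is cut out of the chart by the open condition that the parameter lies in \<open>\<psi> ` ?I\<close>.\<close>
  have "h ` ?I = affine_part l S \<inter> ({x. m 0 \<bullet> x \<noteq> 0} \<inter> r -` (\<psi> ` ?I))"
  proof (intro subset_antisym subsetI)
    fix x assume "x \<in> h ` ?I"
    then obtain t where t: "t \<in> ?I" "x = h t" by auto
    then show "x \<in> affine_part l S \<inter> ({x. m 0 \<bullet> x \<noteq> 0} \<inter> r -` (\<psi> ` ?I))"
      using h(2) span_h S(2) by (auto simp: affine_part_def m c r)
  next
    fix x assume x: "x \<in> affine_part l S \<inter> ({x. m 0 \<bullet> x \<noteq> 0} \<inter> r -` (\<psi> ` ?I))"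
    then have "span {x} \<in> twisted_cubic w"
      using S(1) by (auto simp: affine_part_def)
    then obtain d p q where d: "x = d *\<^sub>R veronese w p q"
      by (rule twisted_cubic_point)
    then have q: "q \<noteq> 0"
      using x by (auto simp: coframe_veronese[OF w])
    obtain t where t: "t \<in> ?I" "r x = \<psi> t" using x by auto
    have "r x = p / q"
      using x q by (auto simp: r_def d coframe_veronese[OF w] power2_eq_square power3_eq_cube)
    then have "x = (d * q ^ 3) *\<^sub>R veronese w (\<psi> t) 1"
      using d veronese_affine[OF q, of w p] t by simp
    then obtain k where k: "x = k *\<^sub>R h t"
      using h(1)[OF t(1)] c[OF t(1)] that[of "d * q ^ 3 / c t"] by simp
    then have "l \<bullet> x = k"
      using h(2)[OF t(1)] by simp
    then have "k = 1"
      using x by (simp add: affine_part_def)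
    then show "x \<in> h ` ?I" using t k by simp
  qed
  moreover have "open ({x. m 0 \<bullet> x \<noteq> 0} \<inter> r -` (\<psi> ` ?I))"
    using cont_r open_image_nonzero_derivative[OF open_greaterThanLessThan \<psi>]
    by (intro continuous_open_preimage) (auto intro!: open_Collect_neq continuous_intros)
  ultimately have "openin (top_of_set (affine_part l S)) (h ` ?I)"
    by (simp add: openin_open_Int)
  then show ?thesis
    unfolding local_param_def
    using e smooth immersion homeo span_h[of 0] by (auto simp: smooth_on_def)
qed

section \<open>Osculating planes of twisted cubics\<close>

text \<open>
  On the point with parameter \<open>(r, s)\<close>, let \<open>a = p s - q r\<close>, which vanishes at the given point, and
  \<open>b = p r + q s\<close>, which does not. The linear forms \<open>A\<close>, \<open>B\<close>, \<open>C\<close>, \<open>D\<close> take the values \<open>a\<^sup>3\<close>, \<open>a\<^sup>2 b\<close>, \<open>a b\<^sup>2\<close>, \<open>b\<^sup>3\<close> on the curve. The quadrics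
  \<open>A D = B C\<close> and \<open>C\<^sup>2 = B D\<close> then make \<open>A\<close> vanish to third order along every smooth parametrization,
  in any chart.
\<close>

lemma osculating_form:
  assumes w: "dual_frames w m" and pq: "p \<noteq> 0 \<or> q \<noteq> 0"
    and g: "local_param (twisted_cubic w) (span {veronese w p q}) l e g"
  shows "veronese (polar_frame m) p q \<bullet> g 0 = 0"
    "veronese (polar_frame m) p q \<bullet> nth_deriv 1 g 0 = 0"
    "veronese (polar_frame m) p q \<bullet> nth_deriv 2 g 0 = 0"
proof -
  define A where "A = veronese (polar_frame m) p q"
  define B where "B = (p\<^sup>2 * q) *\<^sub>R m 0 + (p ^ 3 - 2 * p * q\<^sup>2) *\<^sub>R m 1
      + (q ^ 3 - 2 * p\<^sup>2 * q) *\<^sub>R m 2 + (p * q\<^sup>2) *\<^sub>R m 3"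
  define C where "C = (p * q\<^sup>2) *\<^sub>R m 0 + (2 * p\<^sup>2 * q - q ^ 3) *\<^sub>R m 1
      + (p ^ 3 - 2 * p * q\<^sup>2) *\<^sub>R m 2 - (p\<^sup>2 * q) *\<^sub>R m 3"
  define D where "D = q ^ 3 *\<^sub>R m 0 + (3 * p * q\<^sup>2) *\<^sub>R m 1 + (3 * p\<^sup>2 * q) *\<^sub>R m 2 + p ^ 3 *\<^sub>R m 3"
  note forms = coframe_veronese[OF w] inner_add_left inner_diff_left power2_eq_square power3_eq_cube
  have A: "A \<bullet> veronese w r s = (p * s - q * r) ^ 3" for r s
    unfolding A_def veronese_def[of "polar_frame m"] polar_frame_nth by (simp add: forms) algebra
  have B: "B \<bullet> veronese w r s = (p * s - q * r)\<^sup>2 * (p * r + q * s)" for r s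
    unfolding B_def by (simp add: forms) algebra
  have C: "C \<bullet> veronese w r s = (p * s - q * r) * (p * r + q * s)\<^sup>2" for r s
    unfolding C_def by (simp add: forms) algebra
  have D: "D \<bullet> veronese w r s = (p * r + q * s) ^ 3" for r s
    unfolding D_def by (simp add: forms) algebra
  let ?I = "{-e<..<e}"
  have I: "open ?I" "smooth_on ?I g" "0 \<in> ?I"
    using g local_param_smooth local_param_0 by auto
  have "(A \<bullet> g t) * (D \<bullet> g t) = (B \<bullet> g t) * (C \<bullet> g t)"
       "(C \<bullet> g t) * (C \<bullet> g t) = (B \<bullet> g t) * (D \<bullet> g t)" if "t \<in> ?I" for t
    using local_param_point(2)[OF g that]
    by (auto elim!: twisted_cubic_point simp: A B C D power2_eq_square power3_eq_cube)
  then have AD: "leibniz_sum A D g n 0 = leibniz_sum B C g n 0"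
    and CC: "leibniz_sum C C g n 0 = leibniz_sum B D g n 0" for n
    using leibniz_sum_eq[OF I(1,2) _ I(3)] by blast+
  have "span {g 0} = span {veronese w p q}"
    using g by (simp add: local_param_def)
  then obtain c where c: "g 0 = c *\<^sub>R veronese w p q"
    using span_base[of "g 0" "{g 0}"] by (auto simp: span_singleton)
  moreover have "g 0 \<noteq> 0"
    using local_param_point(1)[OF g I(3)] by auto
  moreover have "p * p + q * q \<noteq> 0"
    using pq by (simp add: sum_squares_eq_zero_iff)
  ultimately have 0: "A \<bullet> g 0 = 0" "B \<bullet> g 0 = 0" "C \<bullet> g 0 = 0" "D \<bullet> g 0 \<noteq> 0"
    by (auto simp: A B C D)
  have B1: "B \<bullet> nth_deriv 1 g 0 = 0"
    using CC[of 1] 0 unfolding leibniz_sum_numeral by simp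
  have A1: "A \<bullet> nth_deriv 1 g 0 = 0"
    using AD[of 1] 0 unfolding leibniz_sum_numeral by simp
  have A2: "A \<bullet> nth_deriv 2 g 0 = 0"
    using AD[of 2] 0 B1 A1 unfolding leibniz_sum_numeral by simp
  show "A \<bullet> g 0 = 0" "A \<bullet> nth_deriv 1 g 0 = 0" "A \<bullet> nth_deriv 2 g 0 = 0"
    by fact+
qed

lemma orthogonal_line_unique:
  fixes y z :: "real ^ 4"
  assumes "dim S = 3" "y \<noteq> 0" "z \<noteq> 0" "\<And>x. x \<in> S \<Longrightarrow> y \<bullet> x = 0" "\<And>x. x \<in> S \<Longrightarrow> z \<bullet> x = 0"
  shows "span {y} = span {z}"
proof -
  define N where "N = {y. \<forall>x\<in>span S. orthogonal x y}"
  have "subspace N"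
    unfolding N_def subspace_def by (auto simp: orthogonal_clauses)
  moreover have "dim N = 1"
    using dim_subspace_orthogonal_to_vectors[of "span S" UNIV] assms(1)
    by (simp add: N_def)
  moreover have "u \<in> N" if "\<And>x. x \<in> S \<Longrightarrow> u \<bullet> x = 0" for u
    unfolding N_def using that orthogonal_to_span[of _ S u] by (auto simp: orthogonal_def inner_commute)
  ultimately have "span {u} = N" if "u \<noteq> 0" "\<And>x. x \<in> S \<Longrightarrow> u \<bullet> x = 0" for u
    using that by (intro subspace_dim_equal subspace_span span_minimal) (simp_all add: dim_span)
  from this[OF assms(2,4)] this[OF assms(3,5)] show ?thesis
    by simp
qed

text \<open>
  The derivatives up to order two of a parametrization span a hyperplane by the dimension condition, so its
  normal line is unique and is the one found in \<open>osculating_form\<close>.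
\<close>

lemma dual_curve_twisted_cubic_subset:
  assumes "dual_frames w m"
  shows "dual_curve (twisted_cubic w) \<subseteq> twisted_cubic (polar_frame m)"
proof
  fix \<sigma> assume "\<sigma> \<in> dual_curve (twisted_cubic w)"
  then obtain P where "P \<in> twisted_cubic w" "osculating_plane (twisted_cubic w) P \<sigma>"
    unfolding dual_curve_def by blast
  moreover from this obtain p q where pq: "p \<noteq> 0 \<or> q \<noteq> 0" and P: "P = span {veronese w p q}"
    unfolding twisted_cubic_def by blast
  ultimately obtain l e g y where
      g: "local_param (twisted_cubic w) (span {veronese w p q}) l e g"
    and "dim {g 0, nth_deriv 1 g 0, nth_deriv 2 g 0} = 3"
    and "\<sigma> = span {y}" "y \<noteq> 0" "y \<bullet> g 0 = 0" "y \<bullet> nth_deriv 1 g 0 = 0" "y \<bullet> nth_deriv 2 g 0 = 0"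
    unfolding osculating_plane_def by blast
  then have "\<sigma> = span {veronese (polar_frame m) p q}"
    using orthogonal_line_unique[of "{g 0, nth_deriv 1 g 0, nth_deriv 2 g 0}" y "veronese (polar_frame m) p q"]
      osculating_form[OF assms pq g] veronese_nonzero[OF polar_frames[OF assms] pq] by auto
  then show "\<sigma> \<in> twisted_cubic (polar_frame m)"
    using pq by (auto simp: twisted_cubic_def)
qed

text \<open>
  In the chart that normalizes the form \<open>m 0\<close>, which takes the value \<open>q\<^sup>3\<close>, the affine parametrization
  \<open>q = 1\<close> needs no denominator.
\<close>

lemma local_param_veronese:
  assumes w: "dual_frames w m"
    and S: "S \<subseteq> twisted_cubic w" "\<And>s. span {veronese w s 1} \<in> S" and "0 < e"
  shows "local_param S (span {veronese w s 1}) (m 0) e (\<lambda>t. veronese w (s + t) 1)"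
proof -
  have "rational_curve {-e<..<e} 1 0 (\<lambda>t. veronese w (s + t) 1)"
    unfolding rational_curve_def
    by (intro exI[of _ 0] exI[of _ "\<lambda>b. [:w 0 \<bullet> b, w 1 \<bullet> b, w 2 \<bullet> b, w 3 \<bullet> b:] \<circ>\<^sub>p [:s, 1:]"])
      (auto simp: monom_1_dvd_iff' veronese_def inner_add_left poly_pcompose algebra_simps
        power2_eq_square power3_eq_cube)
  then have "smooth_on {-e<..<e} (\<lambda>t. veronese w (s + t) 1)"
    by (rule rational_curve_smooth[rotated 2]) auto
  moreover have "((\<lambda>t. s + t) has_real_derivative 1) (at t)" for t
    by (auto intro!: derivative_eq_intros)
  ultimately show ?thesis
    using local_param_twisted_cubic[OF w S assms(4), of "\<lambda>t. veronese w (s + t) 1" "\<lambda>t. s + t" "\<lambda>_. 1" "\<lambda>_. 1" "m 0"]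
    by (simp add: coframe_veronese[OF w])
qed

text \<open>
  The point with parameter \<open>(s, 1)\<close> has the parametrization \<open>veronese w (s + t) 1\<close>, whose value
  and first two derivatives are independent, so \<open>osculating_form\<close> provides the osculating plane.
\<close>

lemma dual_curve_twisted_cubic_superset:
  assumes w: "dual_frames w m"
  shows "span {veronese (polar_frame m) s 1} \<in> dual_curve (twisted_cubic w)"
proof -
  let ?g = "\<lambda>t. veronese w (s + t) 1"
  have g: "local_param (twisted_cubic w) (span {veronese w s 1}) (m 0) 1 ?g"
    using veronese_1_in_twisted_cubic by (intro local_param_veronese[OF w]) auto
  have power: "((\<lambda>t. (s + t) ^ n) has_vector_derivative of_nat n * (s + t) ^ (n - 1)) (at t)" for n t
    unfolding has_real_derivative_iff_has_vector_derivative[symmetric]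
    by (auto intro!: derivative_eq_intros)
  have d1: "nth_deriv 1 ?g = (\<lambda>t. w 1 + (2 * (s + t)) *\<^sub>R w 2 + (3 * (s + t)\<^sup>2) *\<^sub>R w 3)"
    unfolding veronese_def
    by (auto simp: fun_eq_iff vector_derivative_at[OF power] intro!: vector_derivative_at derivative_eq_intros)
  have d2: "nth_deriv 2 ?g = (\<lambda>t. 2 *\<^sub>R w 2 + (6 * (s + t)) *\<^sub>R w 3)"
    unfolding numeral_2_eq_2 nth_deriv_simps(2)[of "Suc 0"] d1[unfolded One_nat_def]
    by (auto simp: fun_eq_iff intro!: vector_derivative_at derivative_eq_intros)
  have pair: "m i \<bullet> w j = of_bool (i = j)" if "i < 4" "j < 4" for i j
    using w that by (simp add: dual_frames_def)
  \<comment> \<open>The forms \<open>m 0\<close>, \<open>m 1\<close>, \<open>m 2\<close> show the three derivative vectors to be in echelon form.\<close>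
  have sep: "x \<notin> span S" if "a \<bullet> x \<noteq> 0" "\<forall>z\<in>S. a \<bullet> z = 0" for a x :: "real ^ 4" and S
    using orthogonal_to_span[of x S a] that by (auto simp: orthogonal_def)
  have "nth_deriv 2 ?g 0 \<noteq> 0"
    unfolding d2 by (auto simp: inner_add_right pair dest: arg_cong[where f = "inner (m 2)"])
  moreover have "nth_deriv 1 ?g 0 \<notin> span {nth_deriv 2 ?g 0}"
    unfolding d1 d2 by (rule sep[of "m 1"]) (simp_all add: inner_add_right pair)
  moreover have "?g 0 \<notin> span {nth_deriv 1 ?g 0, nth_deriv 2 ?g 0}"
    unfolding d1 d2 by (rule sep[of "m 0"]) (simp_all add: inner_add_right pair coframe_veronese[OF w])
  ultimately have "dim {?g 0, nth_deriv 1 ?g 0, nth_deriv 2 ?g 0} = 3"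
    by (simp only: dim_insert dim_empty span_empty) auto
  then have "osculating_plane (twisted_cubic w) (span {veronese w s 1}) (span {veronese (polar_frame m) s 1})"
    unfolding osculating_plane_def
    using g osculating_form[OF w _ g] veronese_nonzero[OF polar_frames[OF w], of s 1]
    by (intro exI[of _ "m 0"] exI[of _ 1] exI[of _ ?g] exI[of _ "veronese (polar_frame m) s 1"]) simp
  then show ?thesis
    unfolding dual_curve_def using veronese_1_in_twisted_cubic by blast
qed

section \<open>The Cayley frames and the jets of a dual curve at omega\<close>

definition cayley_frame :: "real \<Rightarrow> real \<Rightarrow> real \<Rightarrow> nat \<Rightarrow> real ^ 4" where
  "cayley_frame \<alpha> \<beta> \<gamma> = (!)
     [vector [0, 0, 0, (3 - \<beta>) / (3 * \<beta>)],
      vector [0, 0, 1 / \<beta>, \<gamma> * (\<beta> - 1) / \<beta>],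
      vector [0, 1, 0, (\<alpha> - \<beta> * \<gamma>\<^sup>2) / \<beta>],
      vector [1, - \<gamma>, \<alpha> / \<beta>, (\<beta> * \<gamma> ^ 3 - 3 * \<alpha> * \<gamma>) / (3 * \<beta>)]]"

text \<open>
  The linear forms that recover \<open>u\<^sub>1\<^sup>3\<close>, \<open>u\<^sub>0 u\<^sub>1\<^sup>2\<close>, \<open>u\<^sub>0\<^sup>2 u\<^sub>1\<close> and \<open>u\<^sub>0\<^sup>3\<close> from the coordinates of
  \<open>Phi\<close>; only the first of them has the denominator \<open>3 - \<beta>\<close>.
\<close>

definition cayley_coframe :: "real \<Rightarrow> real \<Rightarrow> real \<Rightarrow> nat \<Rightarrow> real ^ 4" where
  "cayley_coframe \<alpha> \<beta> \<gamma> = (!)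
     [vector [(3 * \<alpha> * \<beta> * \<gamma> - 3 * \<alpha> * \<gamma> + 2 * \<beta> * \<gamma> ^ 3) / (3 - \<beta>), - 3 * ((\<alpha> - \<beta> * \<gamma>\<^sup>2) / (3 - \<beta>)),
        3 * \<beta> * (1 - \<beta>) * \<gamma> / (3 - \<beta>), 3 * \<beta> / (3 - \<beta>)],
      vector [- \<alpha>, 0, \<beta>, 0],
      vector [\<gamma>, 1, 0, 0],
      vector [1, 0, 0, 0]]"

lemma cayley_frames:
  assumes "\<beta> \<notin> {0, 3}"
  shows "dual_frames (cayley_frame \<alpha> \<beta> \<gamma>) (cayley_coframe \<alpha> \<beta> \<gamma>)"
  using assms unfolding dual_frames_def less_4_cases cayley_frame_def cayley_coframe_def
  by (simp add: inner_vec_def sum_4 vector_4_nth)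
     (simp add: divide_simps, simp add: algebra_simps power2_eq_square power3_eq_cube)

lemma Phi_eq_veronese:
  assumes "\<beta> \<noteq> 0"
  shows "Phi \<alpha> \<beta> \<gamma> u = veronese (cayley_frame \<alpha> \<beta> \<gamma>) (u $ 1) (u $ 2)"
  using assms
  by (simp add: vec_eq_iff forall_4 Phi_nth veronese_def cayley_frame_def vector_4_nth)
     (simp add: field_simps power2_eq_square power3_eq_cube)

lemma cubic_parabola_eq_twisted_cubic:
  assumes "\<beta> \<noteq> 0"
  shows "cubic_parabola \<alpha> \<beta> \<gamma> = twisted_cubic (cayley_frame \<alpha> \<beta> \<gamma>)"
proof (intro subset_antisym subsetI)
  fix P assume "P \<in> twisted_cubic (cayley_frame \<alpha> \<beta> \<gamma>)"
  then obtain p q where "P = span {veronese (cayley_frame \<alpha> \<beta> \<gamma>) p q}" "p \<noteq> 0 \<or> q \<noteq> 0"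
    by (auto simp: twisted_cubic_def)
  then show "P \<in> cubic_parabola \<alpha> \<beta> \<gamma>"
    unfolding cubic_parabola_def
    by (auto simp: Phi_eq_veronese[OF assms] vec_eq_iff forall_2 intro!: exI[of _ "vector [p, q]"])
qed (auto simp: cubic_parabola_def twisted_cubic_def Phi_eq_veronese[OF assms] vec_eq_iff forall_2)

text \<open>
  The frame of the dual curve of a cubic parabola and its dual frame.
\<close>

definition osculating_frame :: "real \<Rightarrow> real \<Rightarrow> real \<Rightarrow> nat \<Rightarrow> real ^ 4" where
  "osculating_frame \<alpha> \<beta> \<gamma> = polar_frame (cayley_coframe \<alpha> \<beta> \<gamma>)"

definition osculating_coframe :: "real \<Rightarrow> real \<Rightarrow> real \<Rightarrow> nat \<Rightarrow> real ^ 4" where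
  "osculating_coframe \<alpha> \<beta> \<gamma> = polar_coframe (cayley_frame \<alpha> \<beta> \<gamma>)"

lemma osculating_frames:
  assumes "\<beta> \<notin> {0, 3}"
  shows "dual_frames (osculating_frame \<alpha> \<beta> \<gamma>) (osculating_coframe \<alpha> \<beta> \<gamma>)"
  unfolding osculating_frame_def osculating_coframe_def using assms by (intro polar_frames cayley_frames)

lemma osculating_frame_nth:
  "osculating_frame \<alpha> \<beta> \<gamma> 0 = vector [- 1, 0, 0, 0]"
  "osculating_frame \<alpha> \<beta> \<gamma> 1 = vector [3 * \<gamma>, 3, 0, 0]"
  "osculating_frame \<alpha> \<beta> \<gamma> 2 = vector [3 * \<alpha>, 0, - 3 * \<beta>, 0]"
  "osculating_frame \<alpha> \<beta> \<gamma> 3 = cayley_coframe \<alpha> \<beta> \<gamma> 0"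
  by (simp_all add: osculating_frame_def polar_frame_nth[simplified] cayley_coframe_def vec_eq_iff forall_4 vector_4_nth)

lemma osculating_coframe_inner:
  "osculating_coframe \<alpha> \<beta> \<gamma> 0 \<bullet> y = - y $ 1 + \<gamma> * y $ 2 - \<alpha> / \<beta> * y $ 3 - (\<beta> * \<gamma> ^ 3 - 3 * \<alpha> * \<gamma>) / (3 * \<beta>) * y $ 4"
  "osculating_coframe \<alpha> \<beta> \<gamma> 1 \<bullet> y = (y $ 2 + (\<alpha> - \<beta> * \<gamma>\<^sup>2) / \<beta> * y $ 4) / 3"
  "osculating_coframe \<alpha> \<beta> \<gamma> 2 \<bullet> y = - (y $ 3 / \<beta> + \<gamma> * (\<beta> - 1) / \<beta> * y $ 4) / 3"
  "osculating_coframe \<alpha> \<beta> \<gamma> 3 \<bullet> y = (3 - \<beta>) / (3 * \<beta>) * y $ 4"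
  by (simp_all add: osculating_coframe_def polar_coframe_def cayley_frame_def inner_vec_def sum_4 vector_4_nth)

lemma dual_curve_cubic_parabola:
  assumes "\<beta> \<notin> {0, 3}"
  shows "dual_curve (cubic_parabola \<alpha> \<beta> \<gamma>) \<subseteq> twisted_cubic (osculating_frame \<alpha> \<beta> \<gamma>)"
    and "span {veronese (osculating_frame \<alpha> \<beta> \<gamma>) s 1} \<in> dual_curve (cubic_parabola \<alpha> \<beta> \<gamma>)"
  unfolding osculating_frame_def
  using dual_curve_twisted_cubic_subset[OF cayley_frames[OF assms]]
    dual_curve_twisted_cubic_superset[OF cayley_frames[OF assms]] assms
  by (simp_all add: cubic_parabola_eq_twisted_cubic)

lemma omega_dual_point: "omega = span {veronese (osculating_frame \<alpha> \<beta> \<gamma>) 0 1}"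
proof -
  have "veronese (osculating_frame \<alpha> \<beta> \<gamma>) 0 1 = (- 1) *\<^sub>R vector [1, 0, 0, 0]"
    by (simp add: veronese_def osculating_frame_nth vec_eq_iff forall_4 vector_4_nth)
  then show ?thesis
    unfolding omega_def by (simp only: span_scaleR)
qed

lemma local_param_velocity:
  assumes "local_param C P l e g"
  shows "l \<bullet> nth_deriv 1 g 0 = 0"
proof -
  note 0 = local_param_0[OF assms]
  have "((\<lambda>t. l \<bullet> g t) has_vector_derivative l \<bullet> nth_deriv 1 g 0) (at 0)"
    using bounded_linear.has_vector_derivative[OF bounded_linear_inner_right
      smooth_onD[OF local_param_smooth[OF assms] 0, of 0]] by simp
  moreover have "((\<lambda>t. l \<bullet> g t) has_vector_derivative 0) (at 0)"
    by (rule has_vector_derivative_transform_within_open[OF has_vector_derivative_const, of "{-e<..<e}" _ 1])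
      (use 0 local_param_point(1)[OF assms] in auto)
  ultimately show ?thesis
    by (rule vector_derivative_unique_at)
qed

text \<open>
  The relations of order two to four that the quadrics of the dual curve impose on its derivatives \<open>y j\<close> at
  \<open>omega\<close>. The lower orders show that the coordinates 3 and 4 of \<open>y 1\<close> and the coordinate 4 of \<open>y 2\<close>
  vanish, which shortens the later ones. The factors \<open>y 0 $ 1\<close> and \<open>y 1 $ 2\<close> are non-zero because \<open>y 0\<close>
  spans \<open>omega\<close> and \<open>y 1\<close> is not proportional to \<open>y 0\<close>: the chart form \<open>l\<close> is \<open>1\<close> on \<open>y 0\<close> and \<open>0\<close> on
  the velocity \<open>y 1\<close>.
\<close>

lemma jet_at_omega:
  fixes g :: "real \<Rightarrow> real ^ 4"
  assumes \<beta>: "\<beta> \<notin> {0, 3}"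
    and g: "local_param (dual_curve (cubic_parabola \<alpha> \<beta> \<gamma>)) omega l e g"
  defines "y \<equiv> \<lambda>j. nth_deriv j g 0"
  shows "y 0 $ 1 \<noteq> 0" "y 1 $ 2 \<noteq> 0"
    and "2 * \<beta> * (y 1 $ 2)\<^sup>2 = 3 * y 0 $ 1 * y 2 $ 3"
    and "y 1 $ 2 * y 2 $ 3 = (3 - \<beta>) * y 0 $ 1 * y 3 $ 4"
    and "2 * \<beta> * y 1 $ 2 * y 2 $ 2 = y 0 $ 1 * (y 3 $ 3 + \<gamma> * (\<beta> - 1) * y 3 $ 4)
      + 3 * (y 1 $ 1 - \<gamma> * y 1 $ 2) * y 2 $ 3"
    and "4 * y 1 $ 2 * (y 3 $ 3 + \<gamma> * (\<beta> - 1) * y 3 $ 4) + 6 * y 2 $ 2 * y 2 $ 3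
      = 3 * (3 - \<beta>) * (y 0 $ 1 * y 4 $ 4 + 4 * (y 1 $ 1 - \<gamma> * y 1 $ 2) * y 3 $ 4)"
    and "8 * y 1 $ 2 * (\<beta> * y 3 $ 2 + (\<alpha> - \<beta> * \<gamma>\<^sup>2) * y 3 $ 4) + 6 * \<beta> * (y 2 $ 2)\<^sup>2
      = 3 * y 0 $ 1 * (y 4 $ 3 + \<gamma> * (\<beta> - 1) * y 4 $ 4)
        + 12 * (y 1 $ 1 - \<gamma> * y 1 $ 2) * (y 3 $ 3 + \<gamma> * (\<beta> - 1) * y 3 $ 4)
        + 18 * (y 2 $ 1 - \<gamma> * y 2 $ 2 + \<alpha> / \<beta> * y 2 $ 3) * y 2 $ 3"
proof -
  let ?n = "osculating_coframe \<alpha> \<beta> \<gamma>"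
  have nz: "\<beta> \<noteq> 0" "3 - \<beta> \<noteq> 0"
    using \<beta> by auto
  let ?I = "{-e<..<e}"
  have I: "open ?I" "smooth_on ?I g" "0 \<in> ?I"
    using g local_param_smooth local_param_0 by auto
  have "span {g t} \<in> twisted_cubic (osculating_frame \<alpha> \<beta> \<gamma>)" if "t \<in> ?I" for t
    using local_param_point(2)[OF g that] dual_curve_cubic_parabola(1)[OF \<beta>] by blast
  note quadrics = twisted_cubic_quadrics[OF osculating_frames[OF \<beta>] this]
  have Q1: "leibniz_sum (?n 1) (?n 1) g j 0 = leibniz_sum (?n 0) (?n 2) g j 0"
    and Q2: "leibniz_sum (?n 1) (?n 2) g j 0 = leibniz_sum (?n 0) (?n 3) g j 0" for j
    using leibniz_sum_eq[OF I(1,2) quadrics(1) I(3)] leibniz_sum_eq[OF I(1,2) quadrics(2) I(3)] by blast+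
  have y: "nth_deriv j g 0 = y j" for j
    by (simp add: y_def)
  \<comment> \<open>With \<open>i\<close> in place of \<open>1 / \<beta>\<close> all relations are polynomial.\<close>
  define i where "i = 1 / \<beta>"
  have i: "\<beta> * i = 1" "\<alpha> / \<beta> = \<alpha> * i"
    using nz by (simp_all add: i_def)
  have n: "?n 0 \<bullet> v = - v $ 1 + \<gamma> * v $ 2 - \<alpha> * i * v $ 3 - (\<gamma> ^ 3 / 3 - \<alpha> * \<gamma> * i) * v $ 4"
    "?n 1 \<bullet> v = (v $ 2 + (\<alpha> * i - \<gamma>\<^sup>2) * v $ 4) / 3"
    "?n 2 \<bullet> v = - (i * v $ 3 + \<gamma> * (1 - i) * v $ 4) / 3"
    "?n 3 \<bullet> v = (i - 1 / 3) * v $ 4" for v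
    unfolding osculating_coframe_inner i_def using nz by (simp_all add: field_simps)
  note expand = leibniz_sum_numeral[of _ _ g 0, unfolded y] n
  have y0: "y 0 = g 0"
    by (simp add: y_def)
  have "g 0 \<in> omega"
    using g span_base[of "g 0" "{g 0}"] by (auto simp: local_param_def)
  then obtain c where c: "y 0 = vector [c, 0, 0, 0]"
    unfolding omega_def span_singleton y0 by (auto simp: vec_eq_iff forall_4 vector_4_nth)
  have l0: "l \<bullet> y 0 = 1"
    unfolding y0 using local_param_point(1)[OF g I(3)] .
  have c0: "c \<noteq> 0"
    using l0 c by (auto simp: inner_vec_def sum_4 vector_4_nth)
  note pos = c[unfolded y0] y0 vector_4_nth
  have d1: "y 1 $ 4 = 0"
    using Q2[of 1] i nz c0 unfolding expand by (simp add: pos del: One_nat_def) algebra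
  have b1: "y 1 $ 3 = 0"
    using Q1[of 1] i d1 c0 unfolding expand by (auto simp add: pos simp del: One_nat_def)
  have d2: "y 2 $ 4 = 0"
    using Q2[of 2] i nz c0 unfolding expand by (simp add: pos b1 d1 del: One_nat_def) algebra
  note low = pos b1 d1 d2
  show "y 0 $ 1 \<noteq> 0"
    using c0 by (simp add: pos)
  show "y 1 $ 2 \<noteq> 0"
  proof
    assume "y 1 $ 2 = 0"
    then have "y 1 = (y 1 $ 1 / c) *\<^sub>R y 0"
      using b1 d1 c0 by (simp add: c vec_eq_iff forall_4 vector_4_nth del: One_nat_def)
    moreover have "l \<bullet> y 1 = 0"
      unfolding y_def by (rule local_param_velocity[OF g])
    ultimately have "y 1 $ 1 / c = 0"
      using l0 by (metis inner_scaleR_right mult.right_neutral)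
    then have "y 1 = 0"
      using \<open>y 1 = (y 1 $ 1 / c) *\<^sub>R y 0\<close> c0 by auto
    then show False
      using g I(3) unfolding local_param_def y_def by blast
  qed
  show "2 * \<beta> * (y 1 $ 2)\<^sup>2 = 3 * y 0 $ 1 * y 2 $ 3"
    using Q1[of 2] i(1) unfolding expand i(2) by (simp add: low del: One_nat_def) algebra
  show "y 1 $ 2 * y 2 $ 3 = (3 - \<beta>) * y 0 $ 1 * y 3 $ 4"
    using Q2[of 3] i(1) unfolding expand i(2) by (simp add: low del: One_nat_def) algebra
  show "2 * \<beta> * y 1 $ 2 * y 2 $ 2 = y 0 $ 1 * (y 3 $ 3 + \<gamma> * (\<beta> - 1) * y 3 $ 4)
      + 3 * (y 1 $ 1 - \<gamma> * y 1 $ 2) * y 2 $ 3"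
    using Q1[of 3] i(1) unfolding expand i(2) by (simp add: low del: One_nat_def) algebra
  show "4 * y 1 $ 2 * (y 3 $ 3 + \<gamma> * (\<beta> - 1) * y 3 $ 4) + 6 * y 2 $ 2 * y 2 $ 3
      = 3 * (3 - \<beta>) * (y 0 $ 1 * y 4 $ 4 + 4 * (y 1 $ 1 - \<gamma> * y 1 $ 2) * y 3 $ 4)"
    using Q2[of 4] i(1) unfolding expand i(2) by (simp add: low del: One_nat_def) algebra
  show "8 * y 1 $ 2 * (\<beta> * y 3 $ 2 + (\<alpha> - \<beta> * \<gamma>\<^sup>2) * y 3 $ 4) + 6 * \<beta> * (y 2 $ 2)\<^sup>2
      = 3 * y 0 $ 1 * (y 4 $ 3 + \<gamma> * (\<beta> - 1) * y 4 $ 4)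
        + 12 * (y 1 $ 1 - \<gamma> * y 1 $ 2) * (y 3 $ 3 + \<gamma> * (\<beta> - 1) * y 3 $ 4)
        + 18 * (y 2 $ 1 - \<gamma> * y 2 $ 2 + \<alpha> / \<beta> * y 2 $ 3) * y 2 $ 3"
    using Q1[of 4] i(1) unfolding expand i(2) by (simp add: low del: One_nat_def) algebra
qed

section \<open>Parameters determined by dual contact\<close>

text \<open>
  The derivatives satisfy \<open>2 \<beta> (y 1 $ 2)\<^sup>2 = 3 (y 0 $ 1) (y 2 $ 3)\<close>, and everything but \<open>\<beta>\<close> is common to
  both curves.
\<close>

lemma beta_eq_if_dual_contact_2:
  assumes \<beta>: "\<beta> \<notin> {0, 3}" "\<beta>' \<notin> {0, 3}" and "2 \<le> k"
    and "dual_contact k (cubic_parabola \<alpha> \<beta> \<gamma>) (cubic_parabola \<alpha>' \<beta>' \<gamma>') omega"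
  shows "\<beta> = \<beta>'"
proof -
  obtain l e g e' h
    where g: "local_param (dual_curve (cubic_parabola \<alpha> \<beta> \<gamma>)) omega l e g"
      and h: "local_param (dual_curve (cubic_parabola \<alpha>' \<beta>' \<gamma>')) omega l e' h"
      and eq: "\<And>j. j \<le> 2 \<Longrightarrow> nth_deriv j h 0 = nth_deriv j g 0"
    using assms(3,4) unfolding dual_contact_def contact_def by (metis le_trans)
  have "2 * \<beta>' * (nth_deriv 1 g 0 $ 2)\<^sup>2 = 2 * \<beta> * (nth_deriv 1 g 0 $ 2)\<^sup>2"
    using jet_at_omega(3)[OF \<beta>(1) g] jet_at_omega(3)[OF \<beta>(2) h] by (simp only: eq)
  then show ?thesis
    using jet_at_omega(2)[OF \<beta>(1) g] by simp
qed

text \<open>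
  Subtracting the third order relations of the two curves and eliminating \<open>y 1 $ 2 * y 2 $ 3\<close> leaves
  \<open>(\<gamma> - \<gamma>') (4 \<beta> - 10)\<close> times a non-zero factor.
\<close>

lemma gamma_eq_or_beta_if_dual_contact_3:
  assumes \<beta>: "\<beta> \<notin> {0, 3}" and "3 \<le> k"
    and "dual_contact k (cubic_parabola \<alpha> \<beta> \<gamma>) (cubic_parabola \<alpha>' \<beta> \<gamma>') omega"
  shows "\<gamma> = \<gamma>' \<or> \<beta> = 5 / 2"
proof -
  obtain l e g e' h
    where g: "local_param (dual_curve (cubic_parabola \<alpha> \<beta> \<gamma>)) omega l e g"
      and h: "local_param (dual_curve (cubic_parabola \<alpha>' \<beta> \<gamma>')) omega l e' h"
      and eq: "\<And>j. j \<le> 3 \<Longrightarrow> nth_deriv j h 0 = nth_deriv j g 0"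
    using assms(2,3) unfolding dual_contact_def contact_def by (metis le_trans)
  define y where "y j = nth_deriv j g 0" for j
  have h_eq: "nth_deriv j h 0 = y j" if "j \<le> 3" for j
    using eq[OF that] by (simp add: y_def)
  note jet_g = jet_at_omega[OF \<beta> g, folded y_def]
  have "2 * \<beta> * y 1 $ 2 * y 2 $ 2 = y 0 $ 1 * (y 3 $ 3 + \<gamma>' * (\<beta> - 1) * y 3 $ 4)
      + 3 * (y 1 $ 1 - \<gamma>' * y 1 $ 2) * y 2 $ 3"
    using jet_at_omega(5)[OF \<beta> h] by (simp only: h_eq)
  with jet_g(5) have "(\<gamma> - \<gamma>') * ((\<beta> - 1) * (y 0 $ 1 * y 3 $ 4) - 3 * (y 1 $ 2 * y 2 $ 3)) = 0"
    by algebra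
  then have "(\<gamma> - \<gamma>') * (4 * \<beta> - 10) * (y 0 $ 1 * y 3 $ 4) = 0"
    unfolding jet_g(4) by algebra
  moreover have "y 2 $ 3 \<noteq> 0"
    using jet_g(1-3) \<beta> by auto
  then have "y 0 $ 1 * y 3 $ 4 \<noteq> 0"
    using jet_g(2,4) by auto
  ultimately show ?thesis by auto
qed

text \<open>
  The first relation of order four leaves \<open>(\<gamma> - \<gamma>') (4 - \<beta>)\<close> times a non-zero factor. Together with order
  three this excludes \<open>\<gamma> \<noteq> \<gamma>'\<close>, as \<open>\<beta>\<close> cannot be both \<open>4\<close> and \<open>5 / 2\<close>. With \<open>\<gamma> = \<gamma>'\<close> the second
  relation leaves \<open>(\<alpha> - \<alpha>') (3 \<beta> - 7)\<close> times a non-zero factor.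
\<close>

lemma gamma_eq_and_alpha_eq_or_beta_if_dual_contact_4:
  assumes \<beta>: "\<beta> \<notin> {0, 3}" and "4 \<le> k"
    and contact: "dual_contact k (cubic_parabola \<alpha> \<beta> \<gamma>) (cubic_parabola \<alpha>' \<beta> \<gamma>') omega"
  shows "\<gamma> = \<gamma>' \<and> (\<alpha> = \<alpha>' \<or> \<beta> = 7 / 3)"
proof -
  obtain l e g e' h
    where g: "local_param (dual_curve (cubic_parabola \<alpha> \<beta> \<gamma>)) omega l e g"
      and h: "local_param (dual_curve (cubic_parabola \<alpha>' \<beta> \<gamma>')) omega l e' h"
      and eq: "\<And>j. j \<le> 4 \<Longrightarrow> nth_deriv j h 0 = nth_deriv j g 0"
    using assms(2,3) unfolding dual_contact_def contact_def by (metis le_trans)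
  define y where "y j = nth_deriv j g 0" for j
  have h_eq: "nth_deriv j h 0 = y j" if "j \<le> 4" for j
    using eq[OF that] by (simp add: y_def)
  note jet_g = jet_at_omega[OF \<beta> g, folded y_def]
  have nz: "y 2 $ 3 \<noteq> 0"
    using jet_g(1-3) \<beta> by auto
  then have nz': "y 3 $ 4 \<noteq> 0"
    using jet_g(2,4) by auto
  have "4 * y 1 $ 2 * (y 3 $ 3 + \<gamma>' * (\<beta> - 1) * y 3 $ 4) + 6 * y 2 $ 2 * y 2 $ 3
      = 3 * (3 - \<beta>) * (y 0 $ 1 * y 4 $ 4 + 4 * (y 1 $ 1 - \<gamma>' * y 1 $ 2) * y 3 $ 4)"
    using jet_at_omega(6)[OF \<beta> h] by (simp only: h_eq)
  with jet_g(6) have "(\<gamma> - \<gamma>') * (y 1 $ 2 * y 3 $ 4) * (32 - 8 * \<beta>) = 0"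
    by algebra
  then have "\<gamma> = \<gamma>' \<or> \<beta> = 4"
    using nz' jet_g(2) by auto
  then have \<gamma>: "\<gamma> = \<gamma>'"
    using gamma_eq_or_beta_if_dual_contact_3[OF \<beta> _ contact] assms(2) by auto
  have "8 * y 1 $ 2 * (\<beta> * y 3 $ 2 + (\<alpha>' - \<beta> * \<gamma>\<^sup>2) * y 3 $ 4) + 6 * \<beta> * (y 2 $ 2)\<^sup>2
      = 3 * y 0 $ 1 * (y 4 $ 3 + \<gamma> * (\<beta> - 1) * y 4 $ 4)
        + 12 * (y 1 $ 1 - \<gamma> * y 1 $ 2) * (y 3 $ 3 + \<gamma> * (\<beta> - 1) * y 3 $ 4)
        + 18 * (y 2 $ 1 - \<gamma> * y 2 $ 2 + \<alpha>' / \<beta> * y 2 $ 3) * y 2 $ 3"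
    using jet_at_omega(7)[OF \<beta> h] by (simp only: h_eq \<gamma>)
  with jet_g(7) have "8 * y 1 $ 2 * (\<alpha> - \<alpha>') * y 3 $ 4 = 18 * (\<alpha> / \<beta> - \<alpha>' / \<beta>) * (y 2 $ 3)\<^sup>2"
    by algebra
  then have "(\<alpha> - \<alpha>') * (4 * \<beta> * (y 1 $ 2 * y 3 $ 4) - 9 * (y 2 $ 3)\<^sup>2) = 0"
    using \<beta> by (simp add: field_simps)
  then have "(\<alpha> - \<alpha>') * (y 2 $ 3)\<^sup>2 * (y 0 $ 1) * (9 * \<beta> - 21) = 0"
    using jet_g(3,4) by algebra
  then show ?thesis
    using nz jet_g(1) \<gamma> by auto
qed

section \<open>Reparametrizations that produce dual contact\<close>

lemma coeff_mult_low:
  fixes p q :: "'a::comm_semiring_0 poly"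
  shows "coeff (p * q) 0 = coeff p 0 * coeff q 0"
    "coeff (p * q) 1 = coeff p 0 * coeff q 1 + coeff p 1 * coeff q 0"
    "coeff (p * q) 2 = coeff p 0 * coeff q 2 + coeff p 1 * coeff q 1 + coeff p 2 * coeff q 0"
    "coeff (p * q) 3 = coeff p 0 * coeff q 3 + coeff p 1 * coeff q 2 + coeff p 2 * coeff q 1
       + coeff p 3 * coeff q 0"
    "coeff (p * q) 4 = coeff p 0 * coeff q 4 + coeff p 1 * coeff q 3 + coeff p 2 * coeff q 2
       + coeff p 3 * coeff q 1 + coeff p 4 * coeff q 0"
  by (simp_all add: coeff_mult numeral_eq_Suc)

text \<open>
  The coefficient of \<open>t\<^sup>j\<close> in \<open>veronese w (poly U t) (poly V t)\<close>.
\<close>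

definition veronese_coeff :: "(nat \<Rightarrow> real ^ 4) \<Rightarrow> real poly \<Rightarrow> real poly \<Rightarrow> nat \<Rightarrow> real ^ 4" where
  "veronese_coeff w U V j = coeff (V ^ 3) j *\<^sub>R w 0 + coeff (U * V\<^sup>2) j *\<^sub>R w 1
     + coeff (U\<^sup>2 * V) j *\<^sub>R w 2 + coeff (U ^ 3) j *\<^sub>R w 3"

text \<open>
  The hypothesis \<open>jet\<close> says that \<open>veronese w' (poly U t) (poly V t)\<close> and \<open>veronese w t 1\<close> agree up to degree
  \<open>k\<close>. In the chart given by \<open>m 0\<close> the second vector is the representative of its point, and the first has to
  be divided by \<open>q\<close>, its value under \<open>m 0\<close>. As \<open>q\<close> agrees with \<open>1\<close> up to degree \<open>k\<close>, the
  normalized curves still differ by a rational curve that vanishes to order \<open>k + 1\<close>.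
\<close>

lemma contact_twisted_cubics:
  assumes w: "dual_frames w m" and w': "dual_frames w' m'"
    and S: "S \<subseteq> twisted_cubic w" "\<And>s. span {veronese w s 1} \<in> S"
    and S': "S' \<subseteq> twisted_cubic w'" "\<And>s. span {veronese w' s 1} \<in> S'"
    and P: "span {w 0} = P" "span {w' 0} = P"
    and UV: "coeff U 0 = 0" "coeff U 1 \<noteq> 0" "coeff V 0 \<noteq> 0"
    and jet: "\<And>j. j \<le> k \<Longrightarrow> veronese_coeff w' U V j = (if j \<le> 3 then w j else 0)"
  shows "contact k S S' P"
proof -
  define Y where "Y a = smult (a \<bullet> w' 0) (V ^ 3) + smult (a \<bullet> w' 1) (U * V\<^sup>2)
    + smult (a \<bullet> w' 2) (U\<^sup>2 * V) + smult (a \<bullet> w' 3) (U ^ 3)" for a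
  define G where "G a = [:a \<bullet> w 0, a \<bullet> w 1, a \<bullet> w 2, a \<bullet> w 3:]" for a
  have Y: "poly (Y a) t = a \<bullet> veronese w' (poly U t) (poly V t)" for a t
    by (simp add: Y_def veronese_def inner_add_right algebra_simps)
  have G: "poly (G a) t = a \<bullet> veronese w t 1" for a t
    by (simp add: G_def veronese_def inner_add_right algebra_simps power2_eq_square power3_eq_cube)
  have coeff_G: "coeff (G a) j = a \<bullet> (if j \<le> 3 then w j else 0)" for a j
    by (auto simp: G_def coeff_pCons numeral_eq_Suc split: nat.split)
  have YG: "monom 1 (Suc k) dvd Y a - G a" for a
    using jet by (auto simp: monom_1_dvd_iff' coeff_G Y_def less_Suc_eq_le
        inner_add_right veronese_coeff_def simp flip: jet)
  define q where "q = Y (m 0)"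
  have G1: "G (m 0) = 1"
    using w by (simp add: G_def dual_frames_def less_4_cases one_pCons)
  define W where "W = pderiv U * V - U * pderiv V"
  have q0: "poly q 0 = 1"
  proof -
    have "coeff (q - 1) 0 = 0"
      using YG[of "m 0"] unfolding q_def G1 by (simp add: monom_1_dvd_iff')
    then show ?thesis by (simp add: poly_0_coeff_0)
  qed
  have UV0: "poly U 0 = 0" "poly V 0 \<noteq> 0" "poly (pderiv U) 0 \<noteq> 0"
    using UV by (simp_all add: poly_0_coeff_0 coeff_pderiv)
  then have "poly W 0 \<noteq> 0"
    by (simp add: W_def)
  with q0 UV0 have "0 \<in> {t. poly (q * V * W) t \<noteq> 0}" by simp
  moreover have "open {t. poly (q * V * W) t \<noteq> 0}"
    by (intro open_Collect_neq continuous_intros)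
  ultimately obtain e where e: "0 < e" "ball 0 e \<subseteq> {t. poly (q * V * W) t \<noteq> 0}"
    using open_contains_ball by blast
  let ?I = "{-e<..<e}"
  have ne: "poly q t \<noteq> 0" "poly V t \<noteq> 0" "poly W t \<noteq> 0" if "t \<in> ?I" for t
    using e(2) that by (auto simp: subset_iff dist_real_def)
  define g where "g t = veronese w t 1" for t
  define h where "h t = (1 / poly q t) *\<^sub>R veronese w' (poly U t) (poly V t)" for t
  have "rational_curve ?I q 0 h"
    unfolding rational_curve_def h_def using e
    by (intro exI[of _ 1] exI[of _ Y]) (auto simp: Y monom_1_dvd_iff' inner_commute)
  then have smooth_h: "smooth_on ?I h"
    using ne(1) by (intro rational_curve_smooth[of ?I q 0]) auto
  define \<psi> where "\<psi> t = poly U t / poly V t" for t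
  have "local_param S' (span {veronese w' (\<psi> 0) 1}) (m 0) e h"
  proof (rule local_param_twisted_cubic[OF w' S' e(1) smooth_h])
    fix t assume t: "t \<in> ?I"
    show "(\<psi> has_real_derivative (poly W t / (poly V t)\<^sup>2)) (at t)"
      unfolding \<psi>_def W_def using ne(2)[OF t]
      by (auto intro!: derivative_eq_intros simp: power2_eq_square)
    show "poly W t / (poly V t)\<^sup>2 \<noteq> 0"
      using ne[OF t] by simp
    show "h t = (poly V t ^ 3 / poly q t) *\<^sub>R veronese w' (\<psi> t) 1"
      unfolding h_def \<psi>_def using veronese_affine[OF ne(2)[OF t], of w' "poly U t"] by simp
    show "m 0 \<bullet> h t = 1"
      unfolding h_def using ne(1)[OF t] by (simp add: q_def Y)
  qed
  moreover have "\<psi> 0 = 0"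
    using UV0 by (simp add: \<psi>_def)
  ultimately have h: "local_param S' P (m 0) e h"
    using P(2) by (simp add: veronese_def)
  have g: "local_param S P (m 0) e g"
    using local_param_veronese[OF w S e(1), of 0] P(1) by (simp add: g_def[abs_def] veronese_def[of w 0])
  have "rational_curve ?I q (Suc k) (\<lambda>t. h t - g t)"
    unfolding rational_curve_def
  proof (intro exI[of _ 1] exI[of _ "\<lambda>b. Y b - G b * q"] ballI conjI)
    fix b :: "real ^ 4"
    have *: "Y b - G b * q = (Y b - G b) - G b * (Y (m 0) - G (m 0))"
      by (simp add: G1 q_def algebra_simps)
    then show "monom 1 (Suc k) dvd Y b - G b * q"
      unfolding * by (intro dvd_diff dvd_mult YG)
  next
    fix b :: "real ^ 4" and t assume "t \<in> ?I"
    then show "(h t - g t) \<bullet> b = poly (Y b - G b * q) t / poly q t ^ 1"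
      using ne(1)[of t] by (simp add: h_def g_def Y G inner_commute inner_diff_right field_simps)
  qed
  then have "nth_deriv j (\<lambda>t. h t - g t) 0 = 0" if "j \<le> k" for j
    using ne(1) e(1) that by (intro rational_curve_nth_deriv_0[of ?I q "Suc k"]) auto
  then have "nth_deriv j g 0 = nth_deriv j h 0" if "j \<le> k" for j
    using nth_deriv_diff[OF _ smooth_h local_param_smooth[OF g], of 0 j] e(1) that by simp
  then show ?thesis
    unfolding contact_def using g h by blast
qed


text \<open>
  The coefficients of \<open>U\<close> and \<open>V\<close> solve, degree by degree, the equations \<open>J j\<close> for the coordinates 1 and
  2; those of degree four do so if \<open>d = 0\<close> and \<open>\<beta> = 7 / 3\<close>. Coordinate 4 agrees because \<open>U\<close> starts with
  \<open>t\<close>, at degree four with the help of \<open>d = 0\<close>. The equations left over are those for coordinate 3: at degree three it reads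
  \<open>d (4 \<beta> - 10) = 0\<close> up to a non-zero factor, and at degree four, for \<open>d = 0\<close>, it is \<open>2 u3 + v2 = 0\<close>, which
  holds for \<open>\<beta> = 7 / 3\<close>. For smaller \<open>k\<close> the coefficients of higher degree are harmless, so one pair
  \<open>U\<close>, \<open>V\<close> serves all cases.
\<close>

lemma dual_contact_via_reparametrization:
  fixes \<alpha> \<beta> \<gamma> \<alpha>' \<gamma>' :: real
  assumes \<beta>: "\<beta> \<notin> {0, 3}"
    and k: "k = 2 \<or> k = 3 \<and> (\<gamma> = \<gamma>' \<or> \<beta> = 5 / 2) \<or> k = 4 \<and> \<gamma> = \<gamma>' \<and> \<beta> = 7 / 3"
  shows "dual_contact k (cubic_parabola \<alpha> \<beta> \<gamma>) (cubic_parabola \<alpha>' \<beta> \<gamma>') omega"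
proof -
  let ?A = "\<lambda>\<alpha> \<gamma>. (\<alpha> - \<beta> * \<gamma>\<^sup>2) / (3 - \<beta>)"
  let ?B = "\<lambda>\<alpha> \<gamma>. (3 * \<alpha> * \<beta> * \<gamma> - 3 * \<alpha> * \<gamma> + 2 * \<beta> * \<gamma> ^ 3) / (3 - \<beta>)"
  define A A' B B' where AB: "A = ?A \<alpha> \<gamma>" "A' = ?A \<alpha>' \<gamma>'" "B = ?B \<alpha> \<gamma>" "B' = ?B \<alpha>' \<gamma>'"
  define r where "r = 1 / (3 - \<beta>)"
  define d where "d = \<gamma>' - \<gamma>"
  define v2 where "v2 = \<alpha>' - \<alpha> - d\<^sup>2"
  define u3 where "u3 = A' - A + 3 * d\<^sup>2 - 2 * v2"
  define v3 where "v3 = (B' - B + 3 * \<gamma>' * (A' - A) - 9 * \<alpha>' * d - 6 * d * v2 - d ^ 3) / 3"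
  define U where "U = [:0, 1, - 2 * d, u3, - 2 * v3:]"
  define V where "V = [:1, d, v2, v3, - v2\<^sup>2:]"
  have U: "coeff U 0 = 0" "coeff U 1 = 1" "coeff U 2 = - 2 * d" "coeff U 3 = u3" "coeff U 4 = - 2 * v3"
    by (simp_all add: U_def numeral_eq_Suc)
  have V: "coeff V 0 = 1" "coeff V 1 = d" "coeff V 2 = v2" "coeff V 3 = v3" "coeff V 4 = - v2\<^sup>2"
    by (simp_all add: V_def numeral_eq_Suc)
  let ?K = "\<lambda>\<gamma>. 3 * \<beta> * (1 - \<beta>) * \<gamma> * r"
  have F: "osculating_frame \<alpha> \<beta> \<gamma> 3 = vector [B, - 3 * A, ?K \<gamma>, 3 * \<beta> * r]"
    "osculating_frame \<alpha>' \<beta> \<gamma>' 3 = vector [B', - 3 * A', ?K \<gamma>', 3 * \<beta> * r]"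
    by (simp_all add: osculating_frame_nth cayley_coframe_def AB r_def)
  have r: "r * (3 - \<beta>) = 1"
    using \<beta> by (simp add: r_def)
  note product = power3_eq_cube power2_eq_square[of U] power2_eq_square[of V] coeff_mult_low U V
  note expand = veronese_coeff_def F osculating_frame_nth(1-3) vec_eq_iff forall_4 vector_4_nth
  define J where "J j \<longleftrightarrow> veronese_coeff (osculating_frame \<alpha>' \<beta> \<gamma>') U V j
      = (if j \<le> 3 then osculating_frame \<alpha> \<beta> \<gamma> j else 0)" for j
  have J0: "J 0"
    unfolding J_def by (simp add: expand product del: One_nat_def)
  have J1: "J 1"
    unfolding J_def by (simp add: expand product d_def del: One_nat_def)
  have "coeff (V ^ 3) 2 = 3 * (\<alpha>' - \<alpha>)" "coeff (U * V\<^sup>2) 2 = 0"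
      "coeff (U\<^sup>2 * V) 2 = 1" "coeff (U ^ 3) 2 = 0"
    by (simp_all add: product v2_def algebra_simps power2_eq_square del: One_nat_def)
  then have J2: "J 2"
    unfolding J_def by (simp add: expand)
  have J3: "J 3" if "d = 0 \<or> \<beta> = 5 / 2"
  proof -
    have "d * (3 + (1 - \<beta>) * r) = 0"
      using that by (elim disjE) (simp, use r in algebra)
    then have K: "- 3 * \<beta> * (- 3 * d) + ?K \<gamma>' = ?K \<gamma>"
      unfolding d_def by algebra
    have product3: "coeff (V ^ 3) 3 = 3 * v3 + 6 * d * v2 + d ^ 3" "coeff (U * V\<^sup>2) 3 = A' - A"
        "coeff (U\<^sup>2 * V) 3 = - 3 * d" "coeff (U ^ 3) 3 = 1"
      by (simp_all add: product u3_def algebra_simps power2_eq_square del: One_nat_def)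
    have B: "- (3 * v3 + 6 * d * v2 + d ^ 3) + 3 * \<gamma>' * (A' - A) + 3 * \<alpha>' * (- 3 * d) + B' = B"
      by (simp add: v3_def field_simps)
    show ?thesis
      unfolding J_def using K B by (simp add: expand product3 del: One_nat_def) (simp add: algebra_simps)
  qed
  have J4: "J 4" if "d = 0" "\<beta> = 7 / 3"
  proof -
    have "A' - A = (\<alpha>' - \<alpha>) * r"
      using that(1) by (simp add: AB r_def d_def flip: diff_divide_distrib)
    moreover have "v2 = \<alpha>' - \<alpha>"
      using that(1) by (simp add: v2_def)
    ultimately have "2 * (A' - A) = 3 * v2"
      using that(2) r by algebra
    then have "2 * u3 + v2 = 0"
      unfolding u3_def using that by simp
    then have "coeff (V ^ 3) 4 = 0" "coeff (U * V\<^sup>2) 4 = 0"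
        "coeff (U\<^sup>2 * V) 4 = 0" "coeff (U ^ 3) 4 = 0"
      by (simp_all add: product that power2_eq_square del: One_nat_def)
    then show ?thesis
      unfolding J_def by (simp add: veronese_coeff_def)
  qed
  have "J j" if "j \<le> k" for j
  proof -
    have "j = 0 \<or> j = 1 \<or> j = 2 \<or> j = 3 \<and> 3 \<le> k \<or> j = 4 \<and> k = 4"
      using k that by auto
    then show ?thesis
      using J0 J1 J2 J3 J4 k by (auto simp: d_def simp del: One_nat_def)
  qed
  then have jets: "veronese_coeff (osculating_frame \<alpha>' \<beta> \<gamma>') U V j
      = (if j \<le> 3 then osculating_frame \<alpha> \<beta> \<gamma> j else 0)" if "j \<le> k" for j
    using that by (simp add: J_def)
  have P: "span {osculating_frame \<alpha> \<beta> \<gamma> 0} = omega" for \<alpha> \<gamma>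
    unfolding omega_dual_point[of \<alpha> \<beta> \<gamma>] by (simp add: veronese_def)
  show ?thesis
    unfolding dual_contact_def
    using U(1,2) V(1)
    by (intro contact_twisted_cubics[OF osculating_frames[OF \<beta>] osculating_frames[OF \<beta>]
        dual_curve_cubic_parabola[OF \<beta>] dual_curve_cubic_parabola[OF \<beta>] P P _ _ _ jets]) auto
qed

theorem theorem3:
  fixes \<alpha> \<beta> \<gamma> \<alpha>' \<beta>' \<gamma>' :: real
  assumes "\<beta> \<notin> {0, 3}" and "\<beta>' \<notin> {0, 3}"
    and "cubic_parabola \<alpha> \<beta> \<gamma> \<noteq> cubic_parabola \<alpha>' \<beta>' \<gamma>'"
  shows "(dual_contact 2 (cubic_parabola \<alpha> \<beta> \<gamma>) (cubic_parabola \<alpha>' \<beta>' \<gamma>') omega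
            \<longleftrightarrow> \<beta> = \<beta>') \<and>
         (dual_contact 3 (cubic_parabola \<alpha> \<beta> \<gamma>) (cubic_parabola \<alpha>' \<beta>' \<gamma>') omega
            \<longleftrightarrow> (\<beta> = \<beta>' \<and> \<gamma> = \<gamma>') \<or> (\<beta> = \<beta>' \<and> \<beta>' = 5 / 2)) \<and>
         (dual_contact 4 (cubic_parabola \<alpha> \<beta> \<gamma>) (cubic_parabola \<alpha>' \<beta>' \<gamma>') omega
            \<longleftrightarrow> \<beta> = \<beta>' \<and> \<beta>' = 7 / 3 \<and> \<gamma> = \<gamma>')"
proof (cases "\<beta> = \<beta>'")
  case False
  then have "\<not> dual_contact k (cubic_parabola \<alpha> \<beta> \<gamma>) (cubic_parabola \<alpha>' \<beta>' \<gamma>') omega" if "2 \<le> k" for k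
    using beta_eq_if_dual_contact_2[OF assms(1,2) that] by blast
  then show ?thesis
    using False by simp
next
  case True
  let ?contact = "\<lambda>k. dual_contact k (cubic_parabola \<alpha> \<beta> \<gamma>) (cubic_parabola \<alpha>' \<beta> \<gamma>') omega"
  have "?contact 2"
    by (rule dual_contact_via_reparametrization[OF assms(1)]) simp
  moreover have "?contact 3 \<longleftrightarrow> \<gamma> = \<gamma>' \<or> \<beta> = 5 / 2"
    using gamma_eq_or_beta_if_dual_contact_3[OF assms(1) order_refl] dual_contact_via_reparametrization[OF assms(1), of 3]
    by blast
  \<comment> \<open>Curves that are distinct but agree in \<open>\<beta>\<close> and \<open>\<gamma>\<close> have different \<open>\<alpha>\<close>.\<close>
  moreover have "?contact 4 \<longleftrightarrow> \<beta> = 7 / 3 \<and> \<gamma> = \<gamma>'"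
    using gamma_eq_and_alpha_eq_or_beta_if_dual_contact_4[OF assms(1) order_refl] dual_contact_via_reparametrization[OF assms(1), of 4]
      assms(3) True by blast
  ultimately show ?thesis
    using True by auto
qed

end
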